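(* Let $\Gamma$ be a tree with index $r$, i.e. $r$ is the largest eigenvalue of the adjacency matrix of $\Gamma$. Let $\Sigma_\Gamma$ be the set of values of the parameter $\tau$ ($0<\tau\le 1$) for which the $*$-algebra $A_{\Gamma,\tau}$ has nontrivial $*$-representations. Then $$\Sigma_\Gamma=\left(0;\frac{1}{r^2}\right],$$ where $(a;b]$ denotes the half-open interval $\{x: a<x\le b\}$.
   Context: Graphs are finite, undirected, without multiple edges and loops. For a graph $\Gamma$ with vertex set $\{1,\dots,n\}$ and edge set $\Gamma_1$, the adjacency matrix is the $n\times n$ matrix with $(i,j)$ entry $1$ if $(i,j)\in\Gamma_1$ and $0$ otherwise (in particular zero diagonal). For a connected graph $\Gamma$ and a constant $\tau$ with $0<\tau\le 1$ (the same number on every edge), $A_{\Gamma,\tau}$ is the unital $*$-algebra over $\mathbb{C}$ generated by projections $p_1,\dots,p_n$ (that is, $p_i^2=p_i^*=p_i$ for all $i$) subject to the relations: $p_ip_jp_i=\tau p_i$ and $p_jp_ip_j=\tau p_j$ if $(i,j)\in\Gamma_1$; and $p_ip_j=p_jp_i=0$ for distinct $i,j$ with $(i,j)\notin\Gamma_1$. A $*$-representation of $A_{\Gamma,\tau}$ is a unital $*$-homomorphism $\pi$ from $A_{\Gamma,\tau}$ to the bounded operators on a nonzero complex Hilbert space; it is called nontrivial if $\pi(p_i)\neq 0$ for at least one $i$. *)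

theory Defs
  imports
    Complex_Main
    "HOL-Library.Poly_Mapping"
    "HOL-Algebra.QuotRing"
    "HOL-Algebra.Module"
    "Graph_Theory.Graph_Theory"
    "Jordan_Normal_Form.Char_Poly"
begin

section \<open>Graphs\<close>

text \<open>
  A finite simple undirected graph is a \<^locale>\<open>pair_graph\<close>: each edge is present as the two
  opposite arcs. Hence the predicate \<^const>\<open>tree\<close> of the graph library cannot be used here: the
  closed walk \<open>u, v, u\<close> along a single edge is a \<^const>\<open>pre_digraph.cycle\<close>. Cycles of an
  undirected simple graph are those of length at least 3.
\<close>

definition undirected_tree :: "'v pair_pre_digraph \<Rightarrow> bool" where
  "undirected_tree G \<longleftrightarrow>
     pair_graph G \<and> Digraph_Component.connected (with_proj G) \<and>
     \<not> (\<exists>c. pre_digraph.cycle (with_proj G) c \<and> 3 \<le> length c)"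

text \<open>The vertex set is \<open>{1..n}\<close>, whereas matrix indices start at 0.\<close>

definition adjacency_matrix :: "nat pair_pre_digraph \<Rightarrow> real mat" where
  "adjacency_matrix G =
     mat (card (pverts G)) (card (pverts G))
       (\<lambda>(i, j). if (Suc i, Suc j) \<in> parcs G then 1 else 0)"

definition graph_index :: "nat pair_pre_digraph \<Rightarrow> real" where
  "graph_index G = Max {k. eigenvalue (adjacency_matrix G) k}"


section \<open>The *-algebra given by generators and relations\<close>

text \<open>
  The record of a \<open>*\<close>-algebra over the complex numbers; it only carries the operations.
\<close>

record 'a star_algebra = "(complex, 'a) module" +
  involution :: "'a \<Rightarrow> 'a"

text \<open>
  Noncommutative polynomials are the finitely supported functions from words to the complex
  numbers. Concatenation of words is written additively, so that the multiplication of
  \<^theory>\<open>HOL-Library.Poly_Mapping\<close> is the convolution product; the empty word is \<open>0\<close>.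
\<close>

datatype 'v gen_word = Gen_Word (letters: "'v list")

instantiation gen_word :: (type) monoid_add
begin

definition zero_gen_word :: "'a gen_word" where
  "0 = Gen_Word []"

definition plus_gen_word :: "'a gen_word \<Rightarrow> 'a gen_word \<Rightarrow> 'a gen_word" where
  "v + w = Gen_Word (letters v @ letters w)"

instance
  by standard (simp_all add: zero_gen_word_def plus_gen_word_def)

end

type_synonym 'v nc_poly = "'v gen_word \<Rightarrow>\<^sub>0 complex"

definition gen :: "'v \<Rightarrow> 'v nc_poly" where
  "gen i = Poly_Mapping.single (Gen_Word [i]) 1"

definition nc_scale :: "complex \<Rightarrow> 'v nc_poly \<Rightarrow> 'v nc_poly" where
  "nc_scale c f = Poly_Mapping.map ((*) c) f"

definition rev_word :: "'v gen_word \<Rightarrow> 'v gen_word" where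
  "rev_word w = Gen_Word (rev (letters w))"

text \<open>The generators are self-adjoint, so the involution reverses words and conjugates
  coefficients.\<close>

definition nc_star :: "'v nc_poly \<Rightarrow> 'v nc_poly" where
  "nc_star f = Poly_Mapping.map cnj (Poly_Mapping.map_key rev_word f)"

lemma inj_rev_word: "inj rev_word"
  by (rule injI) (auto simp: rev_word_def intro: gen_word.expand)

lemma lookup_nc_scale: "Poly_Mapping.lookup (nc_scale c f) w = c * Poly_Mapping.lookup f w"
  by (simp add: nc_scale_def Poly_Mapping.map.rep_eq when_def)

lemma lookup_nc_star:
  "Poly_Mapping.lookup (nc_star f) w = cnj (Poly_Mapping.lookup f (rev_word w))"
  by (simp add: nc_star_def Poly_Mapping.map.rep_eq map_key.rep_eq inj_rev_word when_def)

definition free_star_algebra :: "'v set \<Rightarrow> 'v nc_poly star_algebra" where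
  "free_star_algebra V =
     \<lparr>carrier = {f. \<forall>w \<in> Poly_Mapping.keys f. set (letters w) \<subseteq> V},
      monoid.mult = (*), one = 1, zero = 0, add = (+), smult = nc_scale, involution = nc_star\<rparr>"

lemma ring_free_star_algebra: "ring (free_star_algebra V)"
proof (rule ringI)
  let ?A = "free_star_algebra V"
  show "abelian_group ?A"
  proof (rule abelian_groupI)
    fix x y assume "x \<in> carrier ?A" "y \<in> carrier ?A"
    then show "x \<oplus>\<^bsub>?A\<^esub> y \<in> carrier ?A"
      using Poly_Mapping.keys_add[of x y] by (auto simp: free_star_algebra_def)
  next
    fix x assume "x \<in> carrier ?A"
    then show "\<exists>y \<in> carrier ?A. y \<oplus>\<^bsub>?A\<^esub> x = \<zero>\<^bsub>?A\<^esub>"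
      by (intro bexI[of _ "- x"]) (auto simp: free_star_algebra_def)
  qed (auto simp: free_star_algebra_def add_ac)
  show "monoid ?A"
  proof (rule monoidI)
    fix x y assume "x \<in> carrier ?A" "y \<in> carrier ?A"
    then show "x \<otimes>\<^bsub>?A\<^esub> y \<in> carrier ?A"
      using Poly_Mapping.keys_mult[of x y]
      by (fastforce simp: free_star_algebra_def plus_gen_word_def)
  qed (auto simp: free_star_algebra_def zero_gen_word_def mult.assoc)
qed (auto simp: free_star_algebra_def distrib_left distrib_right)

text \<open>
  Quotient of a \<open>*\<close>-algebra by an ideal closed under the involution; the scalar multiplication
  and the involution are defined on cosets in the same style as \<^const>\<open>rcoset_mult\<close>.
\<close>

definition quotient_star_algebra :: "'a star_algebra \<Rightarrow> 'a set \<Rightarrow> 'a set star_algebra" where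
  "quotient_star_algebra A I =
     \<lparr>carrier = carrier (A Quot I), monoid.mult = monoid.mult (A Quot I), one = one (A Quot I),
      zero = zero (A Quot I), add = add (A Quot I),
      smult = (\<lambda>c X. \<Union>x\<in>X. I +>\<^bsub>A\<^esub> (c \<odot>\<^bsub>A\<^esub> x)),
      involution = (\<lambda>X. \<Union>x\<in>X. I +>\<^bsub>A\<^esub> involution A x)\<rparr>"

text \<open>
  Arcs occur in both directions, so the second set contains both relations of an edge. The set of
  relators is closed under \<^const>\<open>nc_star\<close>, hence so is the ideal it generates.
\<close>

definition relators :: "'v pair_pre_digraph \<Rightarrow> real \<Rightarrow> 'v nc_poly set" where
  "relators G \<tau> =
     {gen i * gen i - gen i | i. i \<in> pverts G} \<union>
     {gen i * gen j * gen i - nc_scale (complex_of_real \<tau>) (gen i) | i j. (i, j) \<in> parcs G} \<union>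
     {gen i * gen j | i j. i \<in> pverts G \<and> j \<in> pverts G \<and> i \<noteq> j \<and> (i, j) \<notin> parcs G}"

definition relation_ideal :: "'v pair_pre_digraph \<Rightarrow> real \<Rightarrow> 'v nc_poly set" where
  "relation_ideal G \<tau> = genideal (free_star_algebra (pverts G)) (relators G \<tau>)"

definition graph_algebra :: "'v pair_pre_digraph \<Rightarrow> real \<Rightarrow> 'v nc_poly set star_algebra" where
  "graph_algebra G \<tau> =
     quotient_star_algebra (free_star_algebra (pverts G)) (relation_ideal G \<tau>)"

definition proj_gen :: "'v pair_pre_digraph \<Rightarrow> real \<Rightarrow> 'v \<Rightarrow> 'v nc_poly set" where
  "proj_gen G \<tau> i = relation_ideal G \<tau> +>\<^bsub>free_star_algebra (pverts G)\<^esub> gen i"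


section \<open>Hilbert spaces and *-representations\<close>

definition complex_ring :: "complex ring" where
  "complex_ring = \<lparr>carrier = UNIV, monoid.mult = (*), one = 1, zero = 0, add = (+)\<rparr>"

text \<open>
  Hilbert spaces have an explicit carrier, so that one can quantify over all of them inside a
  formula. The fields \<open>mult\<close> and \<open>one\<close> inherited from the module record are unused.
\<close>

record 'h inner_space = "(complex, 'h) module" +
  cinner :: "'h \<Rightarrow> 'h \<Rightarrow> complex"

definition cnorm :: "'h inner_space \<Rightarrow> 'h \<Rightarrow> real" where
  "cnorm H x = sqrt (Re (cinner H x x))"

locale complex_hilbert_space = Module.module complex_ring H for H :: "'h inner_space" +
  assumes cinner_add_left:
      "\<lbrakk>x \<in> carrier H; y \<in> carrier H; z \<in> carrier H\<rbrakk> \<Longrightarrow>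
       cinner H (x \<oplus>\<^bsub>H\<^esub> y) z = cinner H x z + cinner H y z"
    and cinner_scale_left:
      "\<lbrakk>x \<in> carrier H; y \<in> carrier H\<rbrakk> \<Longrightarrow> cinner H (c \<odot>\<^bsub>H\<^esub> x) y = c * cinner H x y"
    and cinner_commute:
      "\<lbrakk>x \<in> carrier H; y \<in> carrier H\<rbrakk> \<Longrightarrow> cinner H x y = cnj (cinner H y x)"
    and cinner_pos:
      "\<lbrakk>x \<in> carrier H; x \<noteq> \<zero>\<^bsub>H\<^esub>\<rbrakk> \<Longrightarrow> 0 < Re (cinner H x x)"
    and complete:
      "\<lbrakk>\<And>n. X n \<in> carrier H;
        \<And>e. 0 < e \<Longrightarrow> \<exists>N. \<forall>m\<ge>N. \<forall>n\<ge>N. cnorm H (X m \<ominus>\<^bsub>H\<^esub> X n) < e\<rbrakk> \<Longrightarrow>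
       \<exists>L \<in> carrier H. (\<lambda>n. cnorm H (X n \<ominus>\<^bsub>H\<^esub> L)) \<longlonglongrightarrow> 0"

definition bounded_operator :: "'h inner_space \<Rightarrow> ('h \<Rightarrow> 'h) \<Rightarrow> bool" where
  "bounded_operator H T \<longleftrightarrow>
     (\<forall>x \<in> carrier H. T x \<in> carrier H) \<and>
     (\<forall>x \<in> carrier H. \<forall>y \<in> carrier H. T (x \<oplus>\<^bsub>H\<^esub> y) = T x \<oplus>\<^bsub>H\<^esub> T y) \<and>
     (\<forall>c. \<forall>x \<in> carrier H. T (c \<odot>\<^bsub>H\<^esub> x) = c \<odot>\<^bsub>H\<^esub> T x) \<and>
     (\<exists>K. \<forall>x \<in> carrier H. cnorm H (T x) \<le> K * cnorm H x)"

definition adjoint_operators :: "'h inner_space \<Rightarrow> ('h \<Rightarrow> 'h) \<Rightarrow> ('h \<Rightarrow> 'h) \<Rightarrow> bool" where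
  "adjoint_operators H S T \<longleftrightarrow>
     (\<forall>x \<in> carrier H. \<forall>y \<in> carrier H. cinner H (S x) y = cinner H x (T y))"

text \<open>
  A unital \<open>*\<close>-homomorphism into the bounded operators. Operators matter only on the carrier of
  the Hilbert space, so their equality is stated pointwise there.
\<close>

definition star_representation ::
  "'a star_algebra \<Rightarrow> 'h inner_space \<Rightarrow> ('a \<Rightarrow> 'h \<Rightarrow> 'h) \<Rightarrow> bool" where
  "star_representation A H \<pi> \<longleftrightarrow>
     complex_hilbert_space H \<and> carrier H \<noteq> {\<zero>\<^bsub>H\<^esub>} \<and>
     (\<forall>a \<in> carrier A. bounded_operator H (\<pi> a)) \<and>
     (\<forall>a \<in> carrier A. \<forall>b \<in> carrier A. \<forall>x \<in> carrier H.
        \<pi> (a \<oplus>\<^bsub>A\<^esub> b) x = \<pi> a x \<oplus>\<^bsub>H\<^esub> \<pi> b x) \<and>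
     (\<forall>c. \<forall>a \<in> carrier A. \<forall>x \<in> carrier H. \<pi> (c \<odot>\<^bsub>A\<^esub> a) x = c \<odot>\<^bsub>H\<^esub> \<pi> a x) \<and>
     (\<forall>a \<in> carrier A. \<forall>b \<in> carrier A. \<forall>x \<in> carrier H. \<pi> (a \<otimes>\<^bsub>A\<^esub> b) x = \<pi> a (\<pi> b x)) \<and>
     (\<forall>x \<in> carrier H. \<pi> \<one>\<^bsub>A\<^esub> x = x) \<and>
     (\<forall>a \<in> carrier A. adjoint_operators H (\<pi> a) (\<pi> (involution A a)))"

definition nontrivial_representation ::
  "'v pair_pre_digraph \<Rightarrow> real \<Rightarrow> 'h inner_space \<Rightarrow> ('v nc_poly set \<Rightarrow> 'h \<Rightarrow> 'h) \<Rightarrow> bool" where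
  "nontrivial_representation G \<tau> H \<pi> \<longleftrightarrow>
     star_representation (graph_algebra G \<tau>) H \<pi> \<and>
     (\<exists>i \<in> pverts G. \<exists>x \<in> carrier H. \<pi> (proj_gen G \<tau> i) x \<noteq> \<zero>\<^bsub>H\<^esub>)"

text \<open>
  The representation spaces are all Hilbert spaces whose carrier is a subset of the type \<open>'h\<close>.
  A nonzero complex Hilbert space has at least as many elements as there are complex numbers, so
  \<open>'h\<close> has to be that large for such spaces to exist at all.
\<close>

definition Sigma_set :: "'h itself \<Rightarrow> 'v pair_pre_digraph \<Rightarrow> real set" where
  "Sigma_set _ G =
     {\<tau>. 0 < \<tau> \<and> \<tau> \<le> 1 \<and>
         (\<exists>(H :: 'h inner_space) \<pi>. nontrivial_representation G \<tau> H \<pi>)}"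

end

theory Submission
  imports
    Defs
    "HOL-Analysis.Function_Topology"
    "HOL-Analysis.L2_Norm"
    "Jordan_Normal_Form.Spectral_Radius"
begin

text \<open>
  Let \<open>A\<close> be the adjacency matrix, with largest eigenvalue \<open>r\<close>. If \<open>\<tau> \<le> 1 / r\<^sup>2\<close>, then
  \<open>1 - sqrt \<tau> * A\<close> is positive semidefinite, hence the Gram matrix of unit vectors \<open>e i\<close>; the
  orthogonal projections onto their spans satisfy the relations. Conversely, in a nontrivial
  representation of a tree one starts with a unit vector in the range of one projection and moves
  along the edges, putting \<open>e v = - p v (e u) / sqrt \<tau>\<close>; as a new vertex has only one neighbour
  among the old ones, this gives unit vectors with Gram matrix \<open>1 - sqrt \<tau> * A\<close>. Testing positivity
  of the Gram matrix on an eigenvector for \<open>r\<close> yields \<open>sqrt \<tau> * r \<le> 1\<close>.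
\<close>

section \<open>Real symmetric matrices indexed by finite sets\<close>

text \<open>The factor 1 / sqrt \<tau> is forced: the edge relation makes \<tau> both the squared
  length of \<open>p v (e u)\<close> and its inner product with \<open>e u\<close>. The sign is a
  choice. A plus sign would give the Gram matrix 1 + sqrt \<tau> * A, whose positivity bounds the
  smallest eigenvalue, so that the symmetry of the spectrum of a bipartite graph would be called
  for; with the minus sign the number r governs both inclusions directly. Acyclicity makes the
  construction consistent: a vertex with two old neighbours would be assigned two vectors, possibly
  different ones. Products of vectors at distinct nonadjacent vertices vanish because the
  projections are orthogonal. A separate obstacle is that representation spaces must be carried by
  the given type \<open>'h\<close>, known only to contain a copy of the complex numbers.
  Finite-dimensional coordinate space is therefore transported along an injection, which exists for
  reasons of cardinality. Finally, an edge gives r \<ge> 1, which makes division by r^2 harmless and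
  places 1 / r^2 in the admissible range of \<tau>.\<close>

lemma sum_quadratic_form_insert:
  fixes M :: "'a \<Rightarrow> 'a \<Rightarrow> real"
  assumes "finite F" "x \<notin> F" and sym: "\<And>i. i \<in> F \<Longrightarrow> M i x = M x i"
  shows "(\<Sum>i\<in>insert x F. \<Sum>j\<in>insert x F. (v(x := t)) i * M i j * (v(x := t)) j) =
     (\<Sum>i\<in>F. \<Sum>j\<in>F. v i * M i j * v j) + 2 * t * (\<Sum>j\<in>F. M x j * v j) + t\<^sup>2 * M x x"
proof -
  have upd: "(v(x := t)) i = v i" if "i \<in> F" for i
    using that assms(2) by auto
  have "(\<Sum>i\<in>F. \<Sum>j\<in>insert x F. (v(x := t)) i * M i j * (v(x := t)) j) =
      (\<Sum>i\<in>F. t * (M x i * v i) + (\<Sum>j\<in>F. v i * M i j * v j))"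
    using assms upd by (intro sum.cong refl) (simp add: mult_ac cong: sum.cong)
  then show ?thesis
    using assms upd
    by (simp add: sum.distrib sum_distrib_left power2_eq_square algebra_simps cong: sum.cong)
qed

text \<open>Cholesky factorization by induction: splitting off \<open>x\<close> leaves the Schur
  complement on \<open>F\<close>, which is again positive semidefinite because its form is the old
  one minimised over the coordinate at \<open>x\<close>. A zero pivot is allowed: positivity then
  kills its whole row, and since division by zero yields 0 the same formulas cover that
  case.\<close>

lemma gram_factorization:
  fixes M :: "'a \<Rightarrow> 'a \<Rightarrow> real"
  assumes "finite S"
    and "\<And>i j. \<lbrakk>i \<in> S; j \<in> S\<rbrakk> \<Longrightarrow> M i j = M j i"
    and "\<And>v. 0 \<le> (\<Sum>i\<in>S. \<Sum>j\<in>S. v i * M i j * v j)"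
  shows "\<exists>e. \<forall>i\<in>S. \<forall>j\<in>S. M i j = (\<Sum>k\<in>S. e i k * e j k)"
  using assms
proof (induction S arbitrary: M)
  case empty
  then show ?case by simp
next
  case (insert x F)
  define d where "d = M x x"
  define Q where "Q v = (\<Sum>i\<in>F. \<Sum>j\<in>F. v i * M i j * v j)" for v
  define B where "B v = (\<Sum>j\<in>F. M x j * v j)" for v
  have pos: "0 \<le> Q v + 2 * t * B v + t\<^sup>2 * d" for v t
    using insert.prems(2)[of "v(x := t)"]
      sum_quadratic_form_insert[OF insert.hyps(1,2), of M v t] insert.prems(1)
    by (simp add: Q_def B_def d_def)
  have d: "0 \<le> d"
    using pos[of "\<lambda>_. 0" 1] by (simp add: Q_def B_def)
  \<comment> \<open>Without a quadratic term the expression in \<open>pos\<close> is affine in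
    \<open>t\<close>, so its slope vanishes; the chosen \<open>t\<close> would give it the value
    -1.\<close>
  have B0: "B v = 0" if "d = 0" for v
  proof (rule ccontr)
    assume "B v \<noteq> 0"
    then show False
      using pos[of v "- (Q v + 1) / (2 * B v)"] that by (simp add: field_simps)
  qed
  have M0: "M i x = 0" if "d = 0" "i \<in> F" for i
  proof -
    have "B (\<lambda>j. if j = i then 1 else 0) = M x i"
      using insert.hyps(1) that(2) by (simp add: B_def if_distrib cong: if_cong)
    then show ?thesis
      using B0[OF that(1)] insert.prems(1) that(2) by simp
  qed
  define M' where "M' i j = M i j - M i x * M j x / d" for i j
  have "\<exists>e. \<forall>i\<in>F. \<forall>j\<in>F. M' i j = (\<Sum>k\<in>F. e i k * e j k)"
  proof (rule insert.IH)
    show "M' i j = M' j i" if "i \<in> F" "j \<in> F" for i j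
      using insert.prems(1) that by (simp add: M'_def)
    fix v
    have "(\<Sum>i\<in>F. \<Sum>j\<in>F. v i * M' i j * v j) =
        (\<Sum>i\<in>F. \<Sum>j\<in>F. v i * M i j * v j - (M x i * v i) * (M x j * v j) / d)"
      using insert.prems(1) by (intro sum.cong refl) (simp add: M'_def algebra_simps)
    also have "\<dots> = Q v - B v * B v / d"
      by (simp add: Q_def B_def sum_subtractf sum_product sum_divide_distrib)
    \<comment> \<open>For positive \<open>d\<close>, \<open>t = - B v / d\<close> minimises the
      quadratic polynomial in \<open>pos\<close>; for \<open>d = 0\<close> it reads 0.\<close>
    also have "\<dots> = Q v + 2 * (- B v / d) * B v + (- B v / d)\<^sup>2 * d"
      by (cases "d = 0") (simp_all add: field_simps power2_eq_square)
    also have "\<dots> \<ge> 0"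
      by (rule pos)
    finally show "0 \<le> (\<Sum>i\<in>F. \<Sum>j\<in>F. v i * M' i j * v j)" .
  qed
  then obtain e where e: "\<And>i j. \<lbrakk>i \<in> F; j \<in> F\<rbrakk> \<Longrightarrow> M' i j = (\<Sum>k\<in>F. e i k * e j k)"
    by blast
  \<comment> \<open>Coordinate \<open>x\<close> is new: the vector of \<open>x\<close> points along
    it with length \<open>sqrt d\<close>, and the other vectors receive the component there that
    reproduces their products with it.\<close>
  define e' where "e' i k = (if k = x then (if i = x then sqrt d else M i x / sqrt d)
      else if i = x then 0 else e i k)" for i k
  have e'x: "e' i x = M i x / sqrt d" "(\<Sum>k\<in>F. e' i k * e' j k) = (\<Sum>k\<in>F. e i k * e j k)"
    if "i \<in> F" "j \<in> F" for i j
    using that insert.hyps(2) by (auto simp: e'_def intro!: sum.cong)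
  have e'xx: "e' x x = sqrt d" "(\<Sum>k\<in>F. e' x k * e' j k) = 0" "(\<Sum>k\<in>F. e' j k * e' x k) = 0" for j
    using insert.hyps(2) by (auto simp: e'_def intro!: sum.neutral)
  have diag: "M x x = (\<Sum>k\<in>insert x F. e' x k * e' x k)"
    using insert.hyps d by (simp add: e'xx d_def)
  have col: "M i x = (\<Sum>k\<in>insert x F. e' i k * e' x k)" if "i \<in> F" for i
    using insert.hyps d M0 that by (cases "d = 0") (simp_all add: e'xx e'x)
  have inner: "M i j = (\<Sum>k\<in>insert x F. e' i k * e' j k)" if "i \<in> F" "j \<in> F" for i j
    using insert.hyps d that e[OF that] e'x(2)[OF that]
    by (cases "d = 0") (simp_all add: e'x M'_def)
  have "M i j = (\<Sum>k\<in>insert x F. e' i k * e' j k)" if "i \<in> insert x F" "j \<in> insert x F" for i j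
    using that diag col inner insert.prems(1) by (auto simp: mult.commute)
  then show ?case by blast
qed

text \<open>A maximiser of the form on the unit sphere is an eigenvector, because no perturbation
  can raise \<open>Q u - m * N u\<close> above 0. Perturbing one coordinate at a time turns this
  condition into exactly one row of the eigenvalue equation and needs only a quadratic polynomial in
  one variable.\<close>

lemma rayleigh_maximum_eigenvector:
  fixes M :: "'a \<Rightarrow> 'a \<Rightarrow> real"
  assumes S: "finite S" "S \<noteq> {}"
    and sym: "\<And>i j. \<lbrakk>i \<in> S; j \<in> S\<rbrakk> \<Longrightarrow> M i j = M j i"
  obtains m v where "\<exists>i\<in>S. v i \<noteq> 0" "\<And>i. i \<in> S \<Longrightarrow> (\<Sum>j\<in>S. M i j * v j) = m * v i"
    "\<And>u. (\<Sum>i\<in>S. \<Sum>j\<in>S. u i * M i j * u j) \<le> m * (\<Sum>i\<in>S. (u i)\<^sup>2)"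
proof -
  define Q where "Q u = (\<Sum>i\<in>S. \<Sum>j\<in>S. u i * M i j * u j)" for u
  define N where "N u = (\<Sum>i\<in>S. (u i)\<^sup>2)" for u :: "'a \<Rightarrow> real"
  \<comment> \<open>Functions on the whole type are confined to a box on \<open>S\<close> and to 0
    elsewhere, so that Tychonoff gives compactness in the product topology; the box contains every
    unit vector supported on \<open>S\<close>.\<close>
  define C :: "('a \<Rightarrow> real) set" where "C = (\<Pi>\<^sub>E i\<in>UNIV. if i \<in> S then {-1..1} else {0})"
  define K where "K = C \<inter> {u. N u = 1}"
  have "compact C"
    unfolding C_def compactin_euclidean_iff[symmetric] euclidean_product_topology[symmetric]
    by (subst compactin_PiE) auto
  moreover have "closed {u. N u = 1}"
    unfolding N_def by (intro closed_Collect_eq continuous_intros continuous_on_product_coordinates)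
  ultimately have "compact K"
    unfolding K_def by (rule compact_Int_closed)
  moreover have "K \<noteq> {}"
  proof -
    obtain i where "i \<in> S" using S by blast
    then have "(\<lambda>j. if j = i then 1 else 0) \<in> K"
      using S(1) by (auto simp: K_def C_def N_def if_distrib[of "\<lambda>x. x\<^sup>2"] cong: if_cong)
    then show ?thesis by blast
  qed
  moreover have "continuous_on K Q"
    unfolding Q_def by (intro continuous_intros continuous_on_subset[OF continuous_on_product_coordinates]) auto
  ultimately have "\<exists>v\<in>K. \<forall>u\<in>K. Q u \<le> Q v"
    by (rule continuous_attains_sup)
  then obtain v where v: "v \<in> K" and max: "\<And>u. u \<in> K \<Longrightarrow> Q u \<le> Q v"
    by blast
  define m where "m = Q v"
  have Nv: "N v = 1" using v by (simp add: K_def)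
  have bound: "Q u \<le> m * N u" for u
  proof (cases "N u = 0")
    case True
    then have "\<forall>i\<in>S. u i = 0"
      using S(1) by (simp add: N_def sum_nonneg_eq_0_iff)
    then show ?thesis
      using True by (simp add: Q_def)
  next
    case False
    define c where "c = sqrt (N u)"
    have c: "c > 0" "c\<^sup>2 = N u"
      using False sum_nonneg[of S "\<lambda>i. (u i)\<^sup>2"] by (auto simp: c_def N_def less_le)
    define w where "w i = (if i \<in> S then u i / c else 0)" for i
    have Nw: "N w = 1"
      using c False by (simp add: N_def w_def power_divide sum_divide_distrib[symmetric] cong: sum.cong)
    have "w i \<in> {-1..1}" if "i \<in> S" for i
    proof -
      have "(w i)\<^sup>2 \<le> N w"
        unfolding N_def using S(1) that by (intro member_le_sum) auto
      then have "\<bar>w i\<bar> \<le> 1" using Nw by (simp add: abs_square_le_1)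
      then show ?thesis by (simp add: abs_le_iff)
    qed
    moreover have "w i = 0" if "i \<notin> S" for i
      using that by (simp add: w_def)
    ultimately have "w \<in> C"
      by (simp add: C_def PiE_iff)
    then have "Q w \<le> m"
      using max Nw by (simp add: m_def K_def)
    moreover have "Q w = Q u / c\<^sup>2"
      by (simp add: Q_def w_def sum_divide_distrib power2_eq_square cong: sum.cong)
    moreover have "N u > 0"
      using c by (metis zero_less_power)
    ultimately show ?thesis
      using c(2) by (simp add: pos_divide_le_eq)
  qed
  have eig: "(\<Sum>j\<in>S. M i j * v j) = m * v i" if i: "i \<in> S" for i
  proof -
    \<comment> \<open>\<open>g\<close> and \<open>h\<close> are half the first and half the second
      derivative of \<open>Q u - m * N u\<close> at \<open>v\<close> in direction
      \<open>i\<close>.\<close>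
    define g where "g = (\<Sum>j\<in>S. M i j * v j) - m * v i"
    define h where "h = M i i - m"
    have split: "S = insert i (S - {i})" using i by blast
    have qv: "Q (v(i := t)) = (\<Sum>k\<in>S - {i}. \<Sum>j\<in>S - {i}. v k * M k j * v j) +
        2 * t * (\<Sum>j\<in>S - {i}. M i j * v j) + t\<^sup>2 * M i i" for t
      unfolding Q_def using sum_quadratic_form_insert[of "S - {i}" i M v t] S(1) sym i split by simp
    have nv: "N (v(i := t)) = (\<Sum>k\<in>S - {i}. (v k)\<^sup>2) + t\<^sup>2" for t
      unfolding N_def by (simp add: sum.remove[OF S(1) i])
    have gs: "(\<Sum>j\<in>S. M i j * v j) = M i i * v i + (\<Sum>j\<in>S - {i}. M i j * v j)"
      by (rule sum.remove[OF S(1) i])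
    have "2 * s * g + s\<^sup>2 * h \<le> 0" for s
    proof -
      have "Q (v(i := v i + s)) - Q (v(i := v i)) - m * (N (v(i := v i + s)) - N (v(i := v i)))
          = 2 * s * g + s\<^sup>2 * h"
        unfolding qv nv g_def h_def gs by (simp add: power2_eq_square algebra_simps)
      then show ?thesis
        using bound[of "v(i := v i + s)"] Nv by (simp add: m_def algebra_simps)
    qed
    note le = this
    have "g = 0"
    proof (rule ccontr)
      assume "g \<noteq> 0"
      \<comment> \<open>\<open>s\<close> has the sign of \<open>g\<close> and is small enough for
        the linear term, which equals \<open>2 * s^2 * (|h| + 1)\<close>, to outweigh
        \<open>s^2 * h\<close>.\<close>
      define s where "s = g / (\<bar>h\<bar> + 1)"
      have g: "g = s * (\<bar>h\<bar> + 1)"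
        by (simp add: s_def)
      have "s\<^sup>2 * (2 * (\<bar>h\<bar> + 1) + h) = 2 * s * g + s\<^sup>2 * h"
        unfolding g by (simp add: power2_eq_square algebra_simps)
      moreover have "s\<^sup>2 * (2 * (\<bar>h\<bar> + 1) + h) > 0"
        using \<open>g \<noteq> 0\<close> by (intro mult_pos_pos) (auto simp: s_def)
      ultimately show False using le[of s] by simp
    qed
    then show ?thesis by (simp add: g_def)
  qed
  have "\<exists>i\<in>S. v i \<noteq> 0"
    using Nv by (auto simp: N_def intro: ccontr)
  then show ?thesis
    using eig bound that unfolding Q_def N_def by blast
qed

section \<open>Adjacency matrices and trees\<close>

definition adj :: "'v pair_pre_digraph \<Rightarrow> 'v \<Rightarrow> 'v \<Rightarrow> real" where
  "adj G i j = (if (i, j) \<in> parcs G then 1 else 0)"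

lemma eigenvalue_adjacency_matrix_iff:
  assumes V: "pverts G = {1..n}"
  shows "eigenvalue (adjacency_matrix G) k \<longleftrightarrow>
    (\<exists>v. (\<exists>i\<in>{1..n}. v i \<noteq> 0) \<and> (\<forall>i\<in>{1..n}. (\<Sum>j\<in>{1..n}. adj G i j * v j) = k * v i))"
proof -
  let ?A = "adjacency_matrix G"
  have A: "?A \<in> carrier_mat n n" "dim_row ?A = n"
    by (simp_all add: adjacency_matrix_def V)
  have img: "{1..n} = Suc ` {0..<n}"
    by (simp add: image_Suc_atLeastLessThan atLeastLessThanSuc_atLeastAtMost)
  \<comment> \<open>Matrix positions start at 0 and vertices at 1, so vertex \<open>j\<close> reads
    entry \<open>j - 1\<close> of \<open>w\<close>.\<close>
  have mul: "vec_index (?A *\<^sub>v w) i = (\<Sum>j\<in>{1..n}. adj G (Suc i) j * vec_index w (j - 1))"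
    if "dim_vec w = n" "i < n" for w i
  proof -
    have "vec_index (?A *\<^sub>v w) i = (\<Sum>j\<in>{0..<n}. adj G (Suc i) (Suc j) * vec_index w j)"
      using that by (simp add: adjacency_matrix_def V scalar_prod_def adj_def)
    also have "\<dots> = (\<Sum>j\<in>Suc ` {0..<n}. adj G (Suc i) j * vec_index w (j - 1))"
      by (subst sum.reindex) simp_all
    finally show ?thesis
      by (simp only: img)
  qed
  show ?thesis
  proof
    assume "eigenvalue ?A k"
    then obtain w where w: "w \<in> carrier_vec n" "w \<noteq> 0\<^sub>v n" "?A *\<^sub>v w = k \<cdot>\<^sub>v w"
      by (auto simp: eigenvalue_def eigenvector_def A)
    have "\<exists>i<n. vec_index w i \<noteq> 0"
      using w(1,2) by (auto simp: vec_eq_iff)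
    then have "\<exists>i\<in>{1..n}. vec_index w (i - 1) \<noteq> 0"
      unfolding img by (auto simp del: image_Suc_atLeastLessThan)
    moreover have "(\<Sum>j\<in>{1..n}. adj G i j * vec_index w (j - 1)) = k * vec_index w (i - 1)"
      if "i \<in> {1..n}" for i
    proof -
      obtain l where l: "i = Suc l" "l < n" using \<open>i \<in> {1..n}\<close> by (cases i) auto
      then show ?thesis
        using mul[of w l] w by (simp add: carrier_vecD)
    qed
    ultimately show "\<exists>v. (\<exists>i\<in>{1..n}. v i \<noteq> 0) \<and>
        (\<forall>i\<in>{1..n}. (\<Sum>j\<in>{1..n}. adj G i j * v j) = k * v i)"
      by (intro exI[of _ "\<lambda>i. vec_index w (i - 1)"]) blast
  next
    assume "\<exists>v. (\<exists>i\<in>{1..n}. v i \<noteq> 0) \<and>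
        (\<forall>i\<in>{1..n}. (\<Sum>j\<in>{1..n}. adj G i j * v j) = k * v i)"
    then obtain v i where v: "i \<in> {1..n}" "v i \<noteq> 0"
      "\<And>i. i \<in> {1..n} \<Longrightarrow> (\<Sum>j\<in>{1..n}. adj G i j * v j) = k * v i"
      by blast
    define w where "w = vec n (\<lambda>i. v (Suc i))"
    have w: "w \<in> carrier_vec n" "vec_index w (i - 1) \<noteq> 0" "i - 1 < n"
      using v(1,2) by (auto simp: w_def)
    then have "w \<noteq> 0\<^sub>v n" by auto
    moreover have "?A *\<^sub>v w = k \<cdot>\<^sub>v w"
    proof (rule eq_vecI)
      fix l assume "l < dim_vec (k \<cdot>\<^sub>v w)"
      then have l: "l < n" by (simp add: w_def)
      have "vec_index (?A *\<^sub>v w) l = (\<Sum>j\<in>{1..n}. adj G (Suc l) j * vec_index w (j - 1))"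
        using l by (intro mul) (simp_all add: w_def)
      also have "\<dots> = (\<Sum>j\<in>{1..n}. adj G (Suc l) j * v j)"
        by (intro sum.cong refl) (auto simp: w_def)
      also have "\<dots> = k * v (Suc l)"
        using l by (intro v(3)) auto
      finally show "vec_index (?A *\<^sub>v w) l = vec_index (k \<cdot>\<^sub>v w) l"
        using l by (simp add: w_def)
    qed (simp add: A w_def)
    ultimately show "eigenvalue ?A k"
      using w(1) by (auto simp: eigenvalue_def eigenvector_def A)
  qed
qed

lemma pair_graph_arc_sym:
  assumes "pair_graph G" "(i, j) \<in> parcs G"
  shows "(j, i) \<in> parcs G"
proof -
  interpret pair_graph G by fact
  show ?thesis using assms(2) by (rule arcs_symmetric)
qed

text \<open>The maximum of the Rayleigh quotient is itself an eigenvalue, hence at most the largest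
  one, so the bound on the form passes to \<open>graph_index G\<close>. A finite and nonempty
  spectrum is what gives \<open>Max\<close> its meaning.\<close>

lemma graph_index_properties:
  assumes G: "pair_graph G" and V: "pverts G = {1..n}" and ab: "(a, b) \<in> parcs G"
  shows graph_index_eigenvector:
      "\<exists>v. (\<exists>i\<in>{1..n}. v i \<noteq> 0) \<and>
        (\<forall>i\<in>{1..n}. (\<Sum>j\<in>{1..n}. adj G i j * v j) = graph_index G * v i)" (is ?eig)
    and adj_form_le_graph_index:
      "(\<Sum>i\<in>{1..n}. \<Sum>j\<in>{1..n}. u i * adj G i j * u j) \<le> graph_index G * (\<Sum>i\<in>{1..n}. (u i)\<^sup>2)"
    and one_le_graph_index: "1 \<le> graph_index G"
proof -
  interpret pair_graph G by fact
  have a: "a \<in> {1..n}" and b: "b \<in> {1..n}" and neq: "a \<noteq> b"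
    using ab wellformed no_loops V by fastforce+
  have sym: "adj G i j = adj G j i" for i j
    using pair_graph_arc_sym[OF G] by (auto simp: adj_def)
  have ne: "{1..n} \<noteq> {}" using a by blast
  obtain m v where mv: "\<exists>i\<in>{1..n}. v i \<noteq> 0"
      "\<And>i. i \<in> {1..n} \<Longrightarrow> (\<Sum>j\<in>{1..n}. adj G i j * v j) = m * v i"
    and bound: "\<And>u. (\<Sum>i\<in>{1..n}. \<Sum>j\<in>{1..n}. u i * adj G i j * u j) \<le> m * (\<Sum>i\<in>{1..n}. (u i)\<^sup>2)"
    by (rule rayleigh_maximum_eigenvector[of "{1..n}" "adj G", OF finite_atLeastAtMost ne sym]) (rule that, assumption+)
  let ?E = "{k. eigenvalue (adjacency_matrix G) k}"
  have fin: "finite ?E"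
    using card_finite_spectrum(1)[of "adjacency_matrix G" n]
    by (simp add: spectrum_def adjacency_matrix_def V)
  have m: "m \<in> ?E"
    using mv by (auto simp: eigenvalue_adjacency_matrix_iff[OF V])
  then have le: "m \<le> graph_index G"
    unfolding graph_index_def using fin by (intro Max_ge)
  have "graph_index G \<in> ?E"
    unfolding graph_index_def using fin m by (intro Max_in) auto
  then show ?eig
    by (simp add: eigenvalue_adjacency_matrix_iff[OF V])
  show form: "(\<Sum>i\<in>{1..n}. \<Sum>j\<in>{1..n}. u i * adj G i j * u j) \<le> graph_index G * (\<Sum>i\<in>{1..n}. (u i)\<^sup>2)"
    for u
    using bound[of u] mult_right_mono[OF le, of "\<Sum>i\<in>{1..n}. (u i)\<^sup>2"]
    by (simp add: sum_nonneg)
  \<comment> \<open>The indicator of the two ends of an edge has squared norm 2, and its form is at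
    least 2, one unit from each of the two arcs.\<close>
  define u :: "nat \<Rightarrow> real" where "u i = (if i \<in> {a, b} then 1 else 0)" for i
  have "(\<Sum>i\<in>{1..n}. \<Sum>j\<in>{1..n}. u i * adj G i j * u j) = (\<Sum>i\<in>{a, b}. \<Sum>j\<in>{a, b}. adj G i j)"
    using a b by (intro sum.mono_neutral_cong_right) (auto simp: u_def intro!: sum.mono_neutral_cong_right)
  also have "\<dots> \<ge> 2"
    using ab neq pair_graph_arc_sym[OF G ab] by (simp add: adj_def)
  finally have "2 \<le> graph_index G * (\<Sum>i\<in>{1..n}. (u i)\<^sup>2)"
    using form[of u] by linarith
  also have "(\<Sum>i\<in>{1..n}. (u i)\<^sup>2) = (\<Sum>i\<in>{a, b}. 1)"
    using a b by (intro sum.mono_neutral_cong_right) (auto simp: u_def)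
  also have "\<dots> = 2"
    using neq by simp
  finally show "1 \<le> graph_index G" by simp
qed

text \<open>A walk from \<open>a\<close> to \<open>b\<close> has to use an arc that leaves
  \<open>S\<close>. The symmetry of the arcs turns connectedness, which ignores directions, into the
  existence of a directed walk.\<close>

lemma connected_arc_leaving:
  assumes "Digraph_Component.connected (with_proj G)" "pair_graph G"
    and "S \<subseteq> pverts G" "a \<in> S" "b \<in> pverts G" "b \<notin> S"
  obtains u v where "u \<in> S" "v \<in> pverts G - S" "(u, v) \<in> parcs G"
proof -
  interpret pair_graph G by fact
  have "strongly_connected (with_proj G)"
    using pair_sym_arcs assms(1) by (rule symmetric_connected_imp_strongly_connected)
  then have "a \<rightarrow>\<^sup>*\<^bsub>with_proj G\<^esub> b"
    using assms by (auto simp: strongly_connected_def)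
  then obtain p where "awalk a p b"
    by (auto simp: reachable_awalk)
  then have "\<exists>u v. u \<in> S \<and> v \<in> pverts G - S \<and> (u, v) \<in> parcs G"
    using assms(4,6)
  proof (induction p arbitrary: a)
    case Nil
    then show ?case by (simp add: awalk_Nil_iff)
  next
    case (Cons e p)
    then have e: "e \<in> parcs G" "fst e = a" "awalk (snd e) p b"
      by (auto simp: awalk_Cons_iff)
    show ?case
    proof (cases "snd e \<in> S")
      case True
      then show ?thesis using Cons e by blast
    next
      case False
      then show ?thesis
        using e Cons.prems(2) arc_snd_in_verts[OF e(1)] by (metis DiffI prod.collapse)
    qed
  qed
  then show ?thesis using that by blast
qed

text \<open>An induction principle for trees: vertices join one by one, each attached to a single
  earlier vertex. A second earlier neighbour would close a cycle together with a path inside the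
  part already built.\<close>

lemma undirected_tree_grow [consumes 2, case_names root extend]:
  assumes tree: "undirected_tree G" and root: "a \<in> pverts G"
    and base: "P {a}"
    and step: "\<And>S u v. \<lbrakk>S \<subseteq> pverts G; P S; u \<in> S; v \<in> pverts G - S; (u, v) \<in> parcs G;
        \<And>w. \<lbrakk>w \<in> S; (w, v) \<in> parcs G\<rbrakk> \<Longrightarrow> w = u\<rbrakk> \<Longrightarrow> P (insert v S)"
  shows "P (pverts G)"
proof -
  have G: "pair_graph G" and con: "Digraph_Component.connected (with_proj G)"
    and acyc: "\<And>c. pre_digraph.cycle (with_proj G) c \<Longrightarrow> length c < 3"
    using tree by (auto simp: undirected_tree_def not_le[symmetric])
  interpret pair_graph G by fact
  \<comment> \<open>The invariant asks for paths that stay inside \<open>S\<close>: such a path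
    avoids the next vertex \<open>v\<close>, so it remains a path when prolonged to
    \<open>v\<close>.\<close>
  define Q where "Q S \<longleftrightarrow> S \<subseteq> pverts G \<and> a \<in> S \<and> P S \<and>
    (\<forall>x\<in>S. \<forall>y\<in>S. \<exists>p. apath x p y \<and> set (awalk_verts x p) \<subseteq> S)" for S
  have grow: "\<exists>v\<in>pverts G - S. Q (insert v S)" if Q: "Q S" and "S \<noteq> pverts G" for S
  proof -
    have S: "S \<subseteq> pverts G" "a \<in> S" "P S"
      and paths: "\<And>x y. \<lbrakk>x \<in> S; y \<in> S\<rbrakk> \<Longrightarrow> \<exists>p. apath x p y \<and> set (awalk_verts x p) \<subseteq> S"
      using Q by (auto simp: Q_def)
    obtain b where b: "b \<in> pverts G" "b \<notin> S" using S(1) \<open>S \<noteq> pverts G\<close> by blast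
    obtain u v where uv: "u \<in> S" "v \<in> pverts G - S" "(u, v) \<in> parcs G"
      using connected_arc_leaving[OF con G S(1,2) b] .
    have to_v: "\<exists>p. apath x (p @ [(w, v)]) v \<and> set (awalk_verts x (p @ [(w, v)])) = insert v (set (awalk_verts x p))
        \<and> apath x p w \<and> set (awalk_verts x p) \<subseteq> S"
      if xw: "x \<in> S" "w \<in> S" "(w, v) \<in> parcs G" for x w
    proof -
      obtain p where p: "apath x p w" "set (awalk_verts x p) \<subseteq> S"
        using paths xw(1,2) by blast
      have w: "awalk x (p @ [(w, v)]) v"
        using p(1) xw(3) uv(2) by (auto simp: apath_def awalk_simps)
      then have "awalk_verts x (p @ [(w, v)]) = awalk_verts x p @ [v]"
        using p(1) by (auto simp: awalk_verts_append[OF w] apath_def)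
      then show ?thesis
        using w p uv(2) by (intro exI[of _ p]) (auto simp: apath_def simp del: awalk_append_iff)
    qed
    have uniq: "w = u" if w: "w \<in> S" "(w, v) \<in> parcs G" for w
    proof (rule ccontr)
      assume "w \<noteq> u"
      obtain p where p: "apath u (p @ [(w, v)]) v" "apath u p w" "set (awalk_verts u p) \<subseteq> S"
        using to_v[OF uv(1) w] by blast
      \<comment> \<open>A nonempty \<open>p\<close> makes the closed walk
        \<open>v, u, ..., w, v\<close> at least three arcs long; only such cycles are excluded,
        since every edge traversed back and forth is a cycle of length 2.\<close>
      have "p \<noteq> []"
        using p(2) \<open>w \<noteq> u\<close> by (auto simp: apath_def awalk_Nil_iff)
      have "(v, u) \<in> parcs G"
        using pair_graph_arc_sym[OF G uv(3)] .
      then have "cycle ((v, u) # p @ [(w, v)])"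
        using p(1) by (auto simp: cycle_def awalk_Cons_iff apath_def)
      then have "length ((v, u) # p @ [(w, v)]) < 3"
        by (rule acyc)
      with \<open>p \<noteq> []\<close> show False by (cases p) auto
    qed
    have "P (insert v S)"
      using step S uv uniq by blast
    moreover have "\<exists>p. apath x p y \<and> set (awalk_verts x p) \<subseteq> insert v S"
      if xy: "x \<in> insert v S" "y \<in> insert v S" for x y
    proof (cases "x = v")
      case True
      show ?thesis
      proof (cases "y = v")
        case True
        then show ?thesis
          using \<open>x = v\<close> uv(2) by (intro exI[of _ "[]"]) (auto simp: apath_Nil_iff)
      next
        case False
        then obtain p where p: "apath u p y" "set (awalk_verts u p) \<subseteq> S"
          using paths uv(1) xy by blast
        then show ?thesis
          using \<open>x = v\<close> uv pair_graph_arc_sym[OF G uv(3)]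
          by (intro exI[of _ "(v, u) # p"]) (auto simp: apath_Cons_iff)
      qed
    next
      case False
      then show ?thesis
      proof (cases "y = v")
        case True
        then show ?thesis
          using to_v[OF _ uv(1,3), of x] False xy by blast
      next
        case False
        then show ?thesis
          using paths[of x y] \<open>x \<noteq> v\<close> xy by blast
      qed
    qed
    ultimately have "Q (insert v S)"
      using S uv(2) by (auto simp: Q_def)
    then show ?thesis using uv(2) by blast
  qed
  have "Q {a}"
    using base root by (auto simp: Q_def apath_Nil_iff intro!: exI[of _ "[]"])
  moreover have "P (pverts G)" if "Q S" for S
    using that
  proof (induction "card (pverts G - S)" arbitrary: S rule: less_induct)
    case less
    show ?case
    proof (cases "S = pverts G")
      case True
      then show ?thesis using less.prems by (simp add: Q_def)
    next
      case False
      then obtain v where v: "v \<in> pverts G - S" "Q (insert v S)"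
        using grow less.prems by blast
      then have "card (pverts G - insert v S) < card (pverts G - S)"
        by (intro psubset_card_mono) auto
      then show ?thesis using less.hyps v(2) by blast
    qed
  qed
  ultimately show ?thesis by blast
qed

section \<open>Arithmetic in the graph algebra\<close>

text \<open>Identities between additive maps need to be checked only on monomials, because an update
  at a fresh key is the addition of one monomial.\<close>

lemma poly_mapping_additive_induct [case_names zero single add]:
  fixes f :: "'a \<Rightarrow>\<^sub>0 'b::comm_monoid_add"
  assumes "P 0" "\<And>k c. P (Poly_Mapping.single k c)" "\<And>f g. \<lbrakk>P f; P g\<rbrakk> \<Longrightarrow> P (f + g)"
  shows "P f"
proof (induction f rule: update_induct)
  case const
  show ?case by fact
next
  case (update f a b)
  have "Poly_Mapping.update a b f = f + Poly_Mapping.single a b"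
    using update(1)
    by (intro poly_mapping_eqI)
      (auto simp: lookup_update lookup_add lookup_single in_keys_iff when_def)
  moreover have "P (f + Poly_Mapping.single a b)"
    using update(3) assms(2) by (rule assms(3))
  ultimately show ?case by simp
qed

lemma nc_scale_add: "nc_scale c (f + g) = nc_scale c f + nc_scale c g"
  by (intro poly_mapping_eqI) (simp add: lookup_nc_scale lookup_add algebra_simps)

lemma nc_scale_single: "nc_scale c (Poly_Mapping.single w d) = Poly_Mapping.single w (c * d)"
  by (intro poly_mapping_eqI) (simp add: lookup_nc_scale lookup_single when_def)

lemma nc_scale_zero [simp]: "nc_scale c 0 = 0"
  by (intro poly_mapping_eqI) (simp add: lookup_nc_scale)

lemma nc_scale_diff: "nc_scale c (f - g) = nc_scale c f - nc_scale c g"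
  by (intro poly_mapping_eqI) (simp add: lookup_nc_scale lookup_minus right_diff_distrib)

lemma nc_star_add: "nc_star (f + g) = nc_star f + nc_star g"
  by (intro poly_mapping_eqI) (simp add: lookup_nc_star lookup_add)

lemma nc_star_zero [simp]: "nc_star 0 = 0"
  by (intro poly_mapping_eqI) (simp add: lookup_nc_star)

lemma nc_star_diff: "nc_star (f - g) = nc_star f - nc_star g"
  by (intro poly_mapping_eqI) (simp add: lookup_nc_star lookup_minus)

lemma nc_star_uminus: "nc_star (- f) = - nc_star f"
  by (intro poly_mapping_eqI) (simp add: lookup_nc_star)

lemma rev_word_rev_word [simp]: "rev_word (rev_word w) = w"
  by (cases w) (simp add: rev_word_def)

lemma rev_word_add: "rev_word (v + w) = rev_word w + rev_word v"
  by (simp add: rev_word_def plus_gen_word_def)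

lemma nc_star_single: "nc_star (Poly_Mapping.single w c) = Poly_Mapping.single (rev_word w) (cnj c)"
proof (rule poly_mapping_eqI)
  fix v :: "'a gen_word"
  have "w = rev_word v \<longleftrightarrow> rev_word w = v"
    by (metis rev_word_rev_word)
  then show "Poly_Mapping.lookup (nc_star (Poly_Mapping.single w c)) v =
      Poly_Mapping.lookup (Poly_Mapping.single (rev_word w) (cnj c)) v"
    by (simp add: lookup_nc_star lookup_single when_def)
qed

lemma nc_star_scale: "nc_star (nc_scale c f) = nc_scale (cnj c) (nc_star f)"
  by (intro poly_mapping_eqI) (simp add: lookup_nc_star lookup_nc_scale)

lemma nc_star_mult: "nc_star (f * g) = nc_star g * nc_star f"
proof (induction f rule: poly_mapping_additive_induct)
  case (single v c)
  show ?case
    by (induction g rule: poly_mapping_additive_induct)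
      (simp_all add: mult_single nc_star_single rev_word_add nc_star_add algebra_simps)
qed (simp_all add: nc_star_add algebra_simps)

lemma nc_star_gen [simp]: "nc_star (gen i) = gen i"
  by (simp add: gen_def nc_star_single rev_word_def)

text \<open>Scalars act as left multiplication by constant polynomials, so an ideal of the ring is
  automatically a complex subspace.\<close>

lemma nc_scale_eq_mult: "nc_scale c f = Poly_Mapping.single 0 c * f"
  by (induction f rule: poly_mapping_additive_induct)
    (simp_all add: mult_single nc_scale_single nc_scale_add algebra_simps)

lemma free_star_algebra_simps [simp]:
  "monoid.mult (free_star_algebra V) = (*)" "one (free_star_algebra V) = 1"
  "zero (free_star_algebra V) = 0" "add (free_star_algebra V) = (+)"
  "smult (free_star_algebra V) = nc_scale" "involution (free_star_algebra V) = nc_star"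
  by (simp_all add: free_star_algebra_def)

lemma free_star_algebra_carrier:
  "f \<in> carrier (free_star_algebra V) \<longleftrightarrow> (\<forall>w \<in> Poly_Mapping.keys f. set (letters w) \<subseteq> V)"
  by (simp add: free_star_algebra_def)

lemma free_star_algebra_a_inv:
  assumes "f \<in> carrier (free_star_algebra V)"
  shows "a_inv (free_star_algebra V) f = - f"
proof -
  interpret ring "free_star_algebra V" by (rule ring_free_star_algebra)
  have "- f \<in> carrier (free_star_algebra V)"
    using assms by (simp add: free_star_algebra_carrier)
  then show ?thesis
    using assms minus_equality[of "- f" f] by simp
qed

lemma free_star_algebra_closed:
  fixes V :: "'v set"
  defines "C \<equiv> carrier (free_star_algebra V)"
  shows "i \<in> V \<Longrightarrow> gen i \<in> C" "0 \<in> C" "1 \<in> C"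
    "\<lbrakk>f \<in> C; g \<in> C\<rbrakk> \<Longrightarrow> f + g \<in> C" "\<lbrakk>f \<in> C; g \<in> C\<rbrakk> \<Longrightarrow> f * g \<in> C"
    "f \<in> C \<Longrightarrow> - f \<in> C" "\<lbrakk>f \<in> C; g \<in> C\<rbrakk> \<Longrightarrow> f - g \<in> C"
    "Poly_Mapping.single 0 c \<in> C" "f \<in> C \<Longrightarrow> nc_scale c f \<in> C" "f \<in> C \<Longrightarrow> nc_star f \<in> C"
proof -
  interpret ring "free_star_algebra V" by (rule ring_free_star_algebra)
  show "0 \<in> C" "1 \<in> C" "\<lbrakk>f \<in> C; g \<in> C\<rbrakk> \<Longrightarrow> f + g \<in> C" "\<lbrakk>f \<in> C; g \<in> C\<rbrakk> \<Longrightarrow> f * g \<in> C"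
    using zero_closed one_closed add.m_closed[of f g] m_closed[of f g] by (simp_all add: C_def)
  show "i \<in> V \<Longrightarrow> gen i \<in> C" "f \<in> C \<Longrightarrow> - f \<in> C" "Poly_Mapping.single 0 c \<in> C"
    by (simp_all add: C_def free_star_algebra_carrier gen_def zero_gen_word_def)
  show "\<lbrakk>f \<in> C; g \<in> C\<rbrakk> \<Longrightarrow> f - g \<in> C"
    using minus_closed[of f g] by (simp add: C_def a_minus_def free_star_algebra_a_inv)
  show "f \<in> C \<Longrightarrow> nc_scale c f \<in> C"
    by (auto simp: C_def free_star_algebra_carrier in_keys_iff lookup_nc_scale)
  assume "f \<in> C"
  have "set (letters w) \<subseteq> V" if "w \<in> Poly_Mapping.keys (nc_star f)" for w
  proof -
    have "rev_word w \<in> Poly_Mapping.keys f"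
      using that by (simp add: in_keys_iff lookup_nc_star)
    then have "set (letters (rev_word w)) \<subseteq> V"
      using \<open>f \<in> C\<close> by (simp add: C_def free_star_algebra_carrier)
    then show ?thesis by (simp add: rev_word_def)
  qed
  then show "nc_star f \<in> C" by (simp add: C_def free_star_algebra_carrier)
qed

section \<open>The relation ideal and computation with cosets\<close>

locale graph_relations =
  fixes G :: "'v pair_pre_digraph" and \<tau> :: real
  assumes arc_verts: "(i, j) \<in> parcs G \<Longrightarrow> i \<in> pverts G \<and> j \<in> pverts G"
    and arc_sym: "(i, j) \<in> parcs G \<Longrightarrow> (j, i) \<in> parcs G"
begin

abbreviation "A \<equiv> free_star_algebra (pverts G)"
abbreviation "I \<equiv> relation_ideal G \<tau>"
abbreviation "Q \<equiv> graph_algebra G \<tau>"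

definition cls :: "'v nc_poly \<Rightarrow> 'v nc_poly set" where
  "cls f = I +>\<^bsub>A\<^esub> f"

sublocale A: ring A by (rule ring_free_star_algebra)

lemmas A_closed = free_star_algebra_closed[where V = "pverts G"]

lemma relators_in_carrier: "relators G \<tau> \<subseteq> carrier A"
proof
  fix f assume "f \<in> relators G \<tau>"
  then consider i where "i \<in> pverts G" "f = gen i * gen i - gen i"
    | i j where "(i, j) \<in> parcs G" "f = gen i * gen j * gen i - nc_scale (complex_of_real \<tau>) (gen i)"
    | i j where "i \<in> pverts G" "j \<in> pverts G" "f = gen i * gen j"
    by (auto simp: relators_def)
  then show "f \<in> carrier A"
    using arc_verts by cases (simp_all add: A_closed)
qed

sublocale I: ideal I A
  unfolding relation_ideal_def by (rule A.genideal_ideal) (rule relators_in_carrier)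

lemma relators_in_ideal: "relators G \<tau> \<subseteq> I"
  unfolding relation_ideal_def by (rule A.genideal_self) (rule relators_in_carrier)

lemma ideal_closed:
  assumes "f \<in> I"
  shows "f \<in> carrier A" "g \<in> I \<Longrightarrow> f + g \<in> I" "- f \<in> I" "g \<in> I \<Longrightarrow> f - g \<in> I"
    "h \<in> carrier A \<Longrightarrow> h * f \<in> I" "h \<in> carrier A \<Longrightarrow> f * h \<in> I" "nc_scale c f \<in> I"
proof -
  show f: "f \<in> carrier A" using assms by (rule I.Icarr)
  show "g \<in> I \<Longrightarrow> f + g \<in> I" "h \<in> carrier A \<Longrightarrow> h * f \<in> I" "h \<in> carrier A \<Longrightarrow> f * h \<in> I"
    using assms I.a_closed[of f g] I.I_l_closed[of f h] I.I_r_closed[of f h] by simp_all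
  have neg: "- h \<in> I" if "h \<in> I" for h
    using I.a_inv_closed[OF that] I.Icarr[OF that] by (simp add: free_star_algebra_a_inv)
  show "- f \<in> I" using assms by (rule neg)
  show "g \<in> I \<Longrightarrow> f - g \<in> I"
    using assms neg[of g] I.a_closed[of f "- g"] by simp
  show "nc_scale c f \<in> I"
    using I.I_l_closed[OF assms A_closed(8)[of c]] by (simp add: nc_scale_eq_mult)
qed

text \<open>The polynomials whose star lies in the ideal form an ideal, so it suffices to look at
  the relators. The first two kinds are self-adjoint, being palindromes with real coefficients;
  reversing a product of the third kind gives another relator because the arcs are
  symmetric.\<close>

lemma ideal_star_closed:
  assumes "f \<in> I"
  shows "nc_star f \<in> I"
proof -
  let ?J = "{f \<in> carrier A. nc_star f \<in> I}"
  have "ideal ?J A"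
  proof (rule idealI)
    show "subgroup ?J (add_monoid A)"
    proof (rule A.add.subgroupI)
      show "?J \<noteq> {}" using I.zero_closed A_closed(2) by (auto intro!: exI[of _ 0])
    qed (auto simp: nc_star_add nc_star_uminus free_star_algebra_a_inv A_closed ideal_closed)
  qed (auto simp: nc_star_mult A_closed ideal_closed A.ring_axioms)
  moreover have "relators G \<tau> \<subseteq> ?J"
  proof
    fix f assume f: "f \<in> relators G \<tau>"
    then have "nc_star f \<in> relators G \<tau>"
      using arc_sym
      by (auto simp: relators_def nc_star_mult nc_star_diff nc_star_scale mult.assoc) blast+
    then show "f \<in> ?J"
      using relators_in_ideal relators_in_carrier f by blast
  qed
  ultimately have "I \<subseteq> ?J"
    unfolding relation_ideal_def by (rule A.genideal_minimal)
  then show ?thesis using assms by blast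
qed

lemma cls_eq_iff:
  assumes "f \<in> carrier A" "g \<in> carrier A"
  shows "cls f = cls g \<longleftrightarrow> f - g \<in> I"
  using A.quotient_eq_iff_same_a_r_cos[OF I.ideal_axioms assms] assms
  by (simp add: cls_def a_minus_def free_star_algebra_a_inv)

lemma mem_cls_iff:
  assumes "f \<in> carrier A"
  shows "g \<in> cls f \<longleftrightarrow> g \<in> carrier A \<and> g - f \<in> I"
proof
  assume "g \<in> cls f"
  then obtain h where "h \<in> I" "g = h + f"
    by (auto simp: cls_def a_r_coset_def')
  then show "g \<in> carrier A \<and> g - f \<in> I"
    using assms by (simp add: ideal_closed A_closed)
next
  assume g: "g \<in> carrier A \<and> g - f \<in> I"
  then show "g \<in> cls f"
    by (auto simp: cls_def a_r_coset_def' intro!: bexI[of _ "g - f"])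
qed

lemma graph_algebra_carrier: "carrier Q = cls ` carrier A"
  by (auto simp: graph_algebra_def quotient_star_algebra_def FactRing_def A_RCOSETS_def' cls_def)

lemma graph_algebra_add:
  "\<lbrakk>f \<in> carrier A; g \<in> carrier A\<rbrakk> \<Longrightarrow> cls f \<oplus>\<^bsub>Q\<^esub> cls g = cls (f + g)"
  using I.a_rcos_sum[of f g]
  by (simp add: graph_algebra_def quotient_star_algebra_def FactRing_def cls_def)

lemma graph_algebra_mult:
  "\<lbrakk>f \<in> carrier A; g \<in> carrier A\<rbrakk> \<Longrightarrow> cls f \<otimes>\<^bsub>Q\<^esub> cls g = cls (f * g)"
  using I.rcoset_mult_add[of f g]
  by (simp add: graph_algebra_def quotient_star_algebra_def FactRing_def cls_def)

lemma graph_algebra_one: "\<one>\<^bsub>Q\<^esub> = cls 1"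
  by (simp add: graph_algebra_def quotient_star_algebra_def FactRing_def cls_def)

text \<open>All members of a coset yield the same coset after scaling, so the union that defines the
  operation collapses to a single term.\<close>

lemma graph_algebra_smult:
  assumes f: "f \<in> carrier A"
  shows "c \<odot>\<^bsub>Q\<^esub> cls f = cls (nc_scale c f)"
proof -
  have "c \<odot>\<^bsub>Q\<^esub> cls f = (\<Union>g\<in>cls f. cls (nc_scale c g))"
    unfolding graph_algebra_def quotient_star_algebra_def cls_def by simp
  also have "\<dots> = cls (nc_scale c f)"
  proof (intro UN_constant_eq ballI)
    show "f \<in> cls f" using f I.zero_closed by (simp add: mem_cls_iff)
    fix g assume "g \<in> cls f"
    then have g: "g \<in> carrier A" "g - f \<in> I" using f by (auto simp: mem_cls_iff)
    show "cls (nc_scale c g) = cls (nc_scale c f)"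
      using f g by (simp add: cls_eq_iff A_closed ideal_closed nc_scale_diff[symmetric])
  qed
  finally show ?thesis .
qed

lemma graph_algebra_involution:
  assumes f: "f \<in> carrier A"
  shows "involution Q (cls f) = cls (nc_star f)"
proof -
  have "involution Q (cls f) = (\<Union>g\<in>cls f. cls (nc_star g))"
    unfolding graph_algebra_def quotient_star_algebra_def cls_def by simp
  also have "\<dots> = cls (nc_star f)"
  proof (intro UN_constant_eq ballI)
    show "f \<in> cls f" using f I.zero_closed by (simp add: mem_cls_iff)
    fix g assume "g \<in> cls f"
    then have g: "g \<in> carrier A" "g - f \<in> I" using f by (auto simp: mem_cls_iff)
    show "cls (nc_star g) = cls (nc_star f)"
      using f g ideal_star_closed[OF g(2)] by (simp add: cls_eq_iff A_closed nc_star_diff)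
  qed
  finally show ?thesis .
qed

lemma proj_gen_eq: "proj_gen G \<tau> i = cls (gen i)"
  by (simp add: proj_gen_def cls_def)

end

section \<open>Families of vectors obtained from a representation\<close>

context complex_hilbert_space
begin

lemma scale_closed: "x \<in> carrier H \<Longrightarrow> c \<odot>\<^bsub>H\<^esub> x \<in> carrier H"
  using smult_closed[of c x] by (simp add: complex_ring_def)

lemma scale_zero: "x \<in> carrier H \<Longrightarrow> 0 \<odot>\<^bsub>H\<^esub> x = \<zero>\<^bsub>H\<^esub>"
  using smult_l_null[of x] by (simp add: complex_ring_def)

lemma cinner_zero_left: "x \<in> carrier H \<Longrightarrow> cinner H \<zero>\<^bsub>H\<^esub> x = 0"
  using cinner_scale_left[of x x 0] by (simp add: scale_zero)

lemma cinner_zero_right: "x \<in> carrier H \<Longrightarrow> cinner H x \<zero>\<^bsub>H\<^esub> = 0"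
  using cinner_commute[of x "\<zero>\<^bsub>H\<^esub>"] by (simp add: cinner_zero_left)

lemma cinner_scale_right:
  "\<lbrakk>x \<in> carrier H; y \<in> carrier H\<rbrakk> \<Longrightarrow> cinner H x (c \<odot>\<^bsub>H\<^esub> y) = cnj c * cinner H x y"
  using cinner_commute[of x "c \<odot>\<^bsub>H\<^esub> y"] cinner_commute[of x y]
  by (simp add: scale_closed cinner_scale_left)

lemma cinner_self_nonneg: "x \<in> carrier H \<Longrightarrow> 0 \<le> Re (cinner H x x)"
  using cinner_pos[of x] by (cases "x = \<zero>\<^bsub>H\<^esub>") (auto simp: cinner_zero_left)

lemma cinner_self_real: "x \<in> carrier H \<Longrightarrow> cinner H x x = complex_of_real (Re (cinner H x x))"
  using cinner_commute[of x x] by (simp add: complex_eq_iff)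

text \<open>The combination is recorded only through its inner products, which is all that the
  positivity argument asks of it.\<close>

lemma linear_combination_exists:
  assumes "finite S" "\<And>i. i \<in> S \<Longrightarrow> e i \<in> carrier H"
  shows "\<exists>y\<in>carrier H. \<forall>z\<in>carrier H. cinner H y z = (\<Sum>i\<in>S. c i * cinner H (e i) z)"
  using assms
proof (induction S rule: finite_induct)
  case empty
  then show ?case by (intro bexI[of _ "\<zero>\<^bsub>H\<^esub>"]) (auto simp: cinner_zero_left)
next
  case (insert x F)
  then obtain y where y: "y \<in> carrier H"
      "\<And>z. z \<in> carrier H \<Longrightarrow> cinner H y z = (\<Sum>i\<in>F. c i * cinner H (e i) z)"
    by auto
  then show ?case
    using insert
    by (intro bexI[of _ "(c x \<odot>\<^bsub>H\<^esub> e x) \<oplus>\<^bsub>H\<^esub> y"])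
      (auto simp: cinner_add_left cinner_scale_left scale_closed)
qed

text \<open>The double sum is the squared norm of the combination of the \<open>e i\<close> with
  real weights \<open>v i\<close>.\<close>

lemma gram_form_nonneg:
  fixes v :: "'i \<Rightarrow> real"
  assumes S: "finite S" and e: "\<And>i. i \<in> S \<Longrightarrow> e i \<in> carrier H"
  shows "0 \<le> Re (\<Sum>i\<in>S. \<Sum>j\<in>S. complex_of_real (v i * v j) * cinner H (e i) (e j))"
proof -
  have "\<exists>y\<in>carrier H. \<forall>z\<in>carrier H.
      cinner H y z = (\<Sum>i\<in>S. complex_of_real (v i) * cinner H (e i) z)"
    using S e by (rule linear_combination_exists)
  then obtain y where y: "y \<in> carrier H"
      "\<And>z. z \<in> carrier H \<Longrightarrow> cinner H y z = (\<Sum>i\<in>S. complex_of_real (v i) * cinner H (e i) z)"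
    by blast
  have "cinner H (e i) y = (\<Sum>j\<in>S. complex_of_real (v j) * cinner H (e i) (e j))" if "i \<in> S" for i
  proof -
    have "cinner H (e i) y = cnj (\<Sum>j\<in>S. complex_of_real (v j) * cinner H (e j) (e i))"
      using cinner_commute[of "e i" y] y e that by simp
    also have "\<dots> = (\<Sum>j\<in>S. complex_of_real (v j) * cnj (cinner H (e j) (e i)))"
      by simp
    also have "\<dots> = (\<Sum>j\<in>S. complex_of_real (v j) * cinner H (e i) (e j))"
      using e that by (intro sum.cong refl) (metis cinner_commute)
    finally show ?thesis .
  qed
  then have "cinner H y y =
      (\<Sum>i\<in>S. \<Sum>j\<in>S. complex_of_real (v i * v j) * cinner H (e i) (e j))"
    using y by (simp add: sum_distrib_left mult.assoc)
  then show ?thesis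
    using cinner_self_nonneg[OF y(1)] by simp
qed

end

section \<open>Unit vectors carried along the edges by a representation\<close>

locale graph_representation = graph_relations G \<tau> + complex_hilbert_space H
  for G :: "'v pair_pre_digraph" and \<tau> :: real and H :: "'h inner_space" +
  fixes \<pi> :: "'v nc_poly set \<Rightarrow> 'h \<Rightarrow> 'h"
  assumes rep: "star_representation (graph_algebra G \<tau>) H \<pi>"
    and tau_pos: "0 < \<tau>"
    and no_loop: "(i, i) \<notin> parcs G"
begin

definition P :: "'v \<Rightarrow> 'h \<Rightarrow> 'h" where
  "P i = \<pi> (cls (gen i))"

lemma rep_cls:
  assumes f: "f \<in> carrier A" and x: "x \<in> carrier H"
  shows "\<pi> (cls f) x \<in> carrier H"
    "\<pi> (cls f) (c \<odot>\<^bsub>H\<^esub> x) = c \<odot>\<^bsub>H\<^esub> \<pi> (cls f) x"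
    "\<pi> (cls (nc_scale c f)) x = c \<odot>\<^bsub>H\<^esub> \<pi> (cls f) x"
    "g \<in> carrier A \<Longrightarrow> \<pi> (cls (f * g)) x = \<pi> (cls f) (\<pi> (cls g) x)"
    "y \<in> carrier H \<Longrightarrow> cinner H (\<pi> (cls f) x) y = cinner H x (\<pi> (cls (nc_star f)) y)"
proof -
  have Q: "cls f \<in> carrier Q" "g \<in> carrier A \<Longrightarrow> cls g \<in> carrier Q" for g
    using f by (auto simp: graph_algebra_carrier)
  show "\<pi> (cls f) x \<in> carrier H" "\<pi> (cls f) (c \<odot>\<^bsub>H\<^esub> x) = c \<odot>\<^bsub>H\<^esub> \<pi> (cls f) x"
    using rep Q(1) x by (auto simp: star_representation_def bounded_operator_def)
  show "\<pi> (cls (nc_scale c f)) x = c \<odot>\<^bsub>H\<^esub> \<pi> (cls f) x"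
    using rep Q(1) x by (simp add: star_representation_def graph_algebra_smult[OF f, symmetric])
  show "\<pi> (cls (f * g)) x = \<pi> (cls f) (\<pi> (cls g) x)" if g: "g \<in> carrier A"
    using rep Q(1) Q(2)[OF g] x
    by (simp add: star_representation_def graph_algebra_mult[OF f g, symmetric])
  show "cinner H (\<pi> (cls f) x) y = cinner H x (\<pi> (cls (nc_star f)) y)" if "y \<in> carrier H"
    using rep Q(1) x that
    by (simp add: star_representation_def adjoint_operators_def graph_algebra_involution[OF f, symmetric])
qed

lemma P_closed: "\<lbrakk>i \<in> pverts G; x \<in> carrier H\<rbrakk> \<Longrightarrow> P i x \<in> carrier H"
  by (simp add: P_def rep_cls A_closed)

lemma P_scale: "\<lbrakk>i \<in> pverts G; x \<in> carrier H\<rbrakk> \<Longrightarrow> P i (c \<odot>\<^bsub>H\<^esub> x) = c \<odot>\<^bsub>H\<^esub> P i x"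
  by (simp add: P_def rep_cls A_closed)

lemma P_selfadjoint:
  "\<lbrakk>i \<in> pverts G; x \<in> carrier H; y \<in> carrier H\<rbrakk> \<Longrightarrow> cinner H (P i x) y = cinner H x (P i y)"
  by (simp add: P_def rep_cls(5) A_closed)

lemma P_idem:
  assumes "i \<in> pverts G" "x \<in> carrier H"
  shows "P i (P i x) = P i x"
proof -
  have "gen i * gen i - gen i \<in> relators G \<tau>"
    using assms by (auto simp: relators_def)
  then have "cls (gen i * gen i) = cls (gen i)"
    using relators_in_ideal assms by (subst cls_eq_iff) (auto simp: A_closed)
  then show ?thesis
    using assms by (simp add: P_def rep_cls(4)[symmetric] A_closed)
qed

lemma P_edge:
  assumes "(i, j) \<in> parcs G" "x \<in> carrier H"
  shows "P i (P j (P i x)) = complex_of_real \<tau> \<odot>\<^bsub>H\<^esub> P i x"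
proof -
  have ij: "i \<in> pverts G" "j \<in> pverts G"
    using arc_verts[OF assms(1)] by auto
  have "gen i * gen j * gen i - nc_scale (complex_of_real \<tau>) (gen i) \<in> relators G \<tau>"
    using assms by (auto simp: relators_def)
  then have "cls (gen i * gen j * gen i) = cls (nc_scale (complex_of_real \<tau>) (gen i))"
    using relators_in_ideal ij by (subst cls_eq_iff) (auto simp: A_closed)
  moreover have "\<pi> (cls (gen i * gen j * gen i)) x = P i (P j (P i x))"
    using assms ij by (simp add: P_def rep_cls A_closed)
  ultimately show ?thesis
    using assms ij by (simp add: P_def rep_cls A_closed)
qed

lemma P_nonedge:
  assumes "i \<in> pverts G" "j \<in> pverts G" "i \<noteq> j" "(i, j) \<notin> parcs G" "x \<in> carrier H"
  shows "P i (P j x) = \<zero>\<^bsub>H\<^esub>"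
proof -
  have "gen i * gen j \<in> relators G \<tau>"
    using assms by (auto simp: relators_def)
  \<comment> \<open>Writing 0 as \<open>nc_scale 0 0\<close> reduces its action to the compatibility
    of the representation with scalars.\<close>
  then have "cls (gen i * gen j) = cls (nc_scale 0 0)"
    using relators_in_ideal assms by (subst cls_eq_iff) (auto simp: A_closed)
  moreover have "\<pi> (cls (nc_scale 0 0)) x = \<zero>\<^bsub>H\<^esub>"
    using rep_cls(3)[of 0 x 0] rep_cls(1)[of 0 x] assms(5) by (simp add: A_closed scale_zero)
  ultimately show ?thesis
    using assms by (simp add: P_def rep_cls(4)[symmetric] A_closed)
qed

text \<open>Only products along arcs are prescribed: for distinct nonadjacent vertices they vanish
  by \<open>P_nonedge\<close>, since each vector lies in the range of its projection. An extension
  therefore has to compare the new vertex with its single neighbour only.\<close>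

definition linked_family :: "'v set \<Rightarrow> ('v \<Rightarrow> 'h) \<Rightarrow> bool" where
  "linked_family S e \<longleftrightarrow>
     (\<forall>i\<in>S. e i \<in> carrier H \<and> P i (e i) = e i \<and> cinner H (e i) (e i) = 1) \<and>
     (\<forall>i\<in>S. \<forall>j\<in>S. (i, j) \<in> parcs G \<longrightarrow> cinner H (e i) (e j) = - complex_of_real (sqrt \<tau>))"

lemma linked_family_root:
  assumes "i \<in> pverts G" "x \<in> carrier H" "P i x \<noteq> \<zero>\<^bsub>H\<^esub>"
  shows "\<exists>e. linked_family {i} e"
proof -
  define q where "q = Re (cinner H (P i x) (P i x))"
  have Px: "P i x \<in> carrier H" and q: "0 < q"
    using assms cinner_pos[of "P i x"] by (auto simp: P_closed q_def)
  have self: "cinner H (P i x) (P i x) = complex_of_real q"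
    using cinner_self_real[OF Px] by (simp add: q_def)
  define t where "t = 1 / sqrt q"
  define y where "y = complex_of_real t \<odot>\<^bsub>H\<^esub> P i x"
  have y: "y \<in> carrier H" "P i y = y"
    using assms Px by (simp_all add: y_def scale_closed P_scale P_idem)
  have "cinner H y y = complex_of_real (t * (t * q))"
    using Px self by (simp add: y_def cinner_scale_left cinner_scale_right scale_closed)
  also have "t * (t * q) = 1"
    using q by (simp add: t_def field_simps)
  finally show ?thesis
    using y no_loop by (intro exI[of _ "\<lambda>_. y"]) (simp add: linked_family_def)
qed

lemma linked_family_extend:
  assumes S: "S \<subseteq> pverts G" "u \<in> S" "v \<in> pverts G - S" "(u, v) \<in> parcs G"
    and uniq: "\<And>w. \<lbrakk>w \<in> S; (w, v) \<in> parcs G\<rbrakk> \<Longrightarrow> w = u"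
    and e: "linked_family S e"
  shows "\<exists>e'. linked_family (insert v S) e'"
proof -
  have u: "u \<in> pverts G" "e u \<in> carrier H" "P u (e u) = e u" "cinner H (e u) (e u) = 1"
    and v: "v \<in> pverts G" "v \<notin> S"
    using S e by (auto simp: linked_family_def)
  define s where "s = complex_of_real (- 1 / sqrt \<tau>)"
  have s: "cnj s = s" "s * (s * complex_of_real \<tau>) = 1" "s * complex_of_real \<tau> = - complex_of_real (sqrt \<tau>)"
    using tau_pos
    by (simp_all add: s_def of_real_mult[symmetric] of_real_minus[symmetric] del: of_real_mult of_real_minus)
      (simp_all add: real_div_sqrt)
  have Pv: "P v (e u) \<in> carrier H"
    using u v by (simp add: P_closed)
  \<comment> \<open>\<open>P u\<close> fixes \<open>e u\<close> and is self-adjoint, so it can be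
    inserted on both sides of \<open>P v\<close>, where the edge relation applies.\<close>
  have uPv: "cinner H (e u) (P v (e u)) = complex_of_real \<tau>"
  proof -
    have "cinner H (e u) (P v (e u)) = cinner H (P u (e u)) (P v (P u (e u)))"
      using u by simp
    also have "\<dots> = cinner H (e u) (P u (P v (P u (e u))))"
      using u Pv by (subst P_selfadjoint) simp_all
    also have "P u (P v (P u (e u))) = complex_of_real \<tau> \<odot>\<^bsub>H\<^esub> e u"
      using P_edge[OF S(4), of "e u"] u by simp
    also have "cinner H (e u) (complex_of_real \<tau> \<odot>\<^bsub>H\<^esub> e u) = complex_of_real \<tau>"
      using u by (simp add: cinner_scale_right)
    finally show ?thesis .
  qed
  define y where "y = s \<odot>\<^bsub>H\<^esub> P v (e u)"
  have y: "y \<in> carrier H" "P v y = y"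
    using u v Pv by (simp_all add: y_def scale_closed P_scale P_idem)
  have uy: "cinner H (e u) y = - complex_of_real (sqrt \<tau>)"
    using u Pv s uPv by (simp add: y_def cinner_scale_right)
  have yu: "cinner H y (e u) = - complex_of_real (sqrt \<tau>)"
    using cinner_commute[of y "e u"] u y uy by simp
  \<comment> \<open>Since \<open>P v\<close> is a projection, the squared norm is the inner product
    just found, namely \<tau>; this is why \<open>s\<close> normalises the vector.\<close>
  have "cinner H (P v (e u)) (P v (e u)) = cinner H (e u) (P v (e u))"
    using u v Pv by (simp add: P_selfadjoint P_idem)
  then have yy: "cinner H y y = 1"
    using Pv s uPv
    by (simp add: y_def cinner_scale_left cinner_scale_right scale_closed)
  have "linked_family (insert v S) (e(v := y))"
    unfolding linked_family_def
  proof (intro conjI ballI impI)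
    fix i assume "i \<in> insert v S"
    then show "(e(v := y)) i \<in> carrier H" "P i ((e(v := y)) i) = (e(v := y)) i"
      "cinner H ((e(v := y)) i) ((e(v := y)) i) = 1"
      using e y yy v by (auto simp: linked_family_def)
  next
    fix i j assume "i \<in> insert v S" "j \<in> insert v S" and ij: "(i, j) \<in> parcs G"
    then consider "i \<in> S" "j \<in> S" | "i \<in> S" "j = v" | "i = v" "j \<in> S"
      using no_loop by auto
    then show "cinner H ((e(v := y)) i) ((e(v := y)) j) = - complex_of_real (sqrt \<tau>)"
    proof cases
      case 1
      then have "i \<noteq> v" "j \<noteq> v" using v by auto
      then show ?thesis using 1 ij e by (simp add: linked_family_def)
    next
      case 2
      then have "i = u" using uniq ij by simp
      then show ?thesis using 2 uy v by auto
    next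
      case 3
      then have "j = u" using uniq arc_sym[OF ij] by simp
      then show ?thesis using 3 yu v by auto
    qed
  qed
  then show ?thesis by blast
qed

lemma linked_family_cinner:
  assumes e: "linked_family (pverts G) e" and ij: "i \<in> pverts G" "j \<in> pverts G"
  shows "cinner H (e i) (e j) = complex_of_real ((if i = j then 1 else 0) - sqrt \<tau> * adj G i j)"
proof -
  have e': "\<And>i. i \<in> pverts G \<Longrightarrow> e i \<in> carrier H \<and> P i (e i) = e i"
    using e by (simp add: linked_family_def)
  consider "i = j" | "(i, j) \<in> parcs G" "i \<noteq> j" | "i \<noteq> j" "(i, j) \<notin> parcs G" by blast
  then show ?thesis
  proof cases
    case 3
    have "cinner H (e i) (e j) = cinner H (P i (e i)) (P j (e j))"
      using e' ij by simp
    also have "\<dots> = cinner H (e i) (P i (P j (e j)))"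
      using e' ij by (subst P_selfadjoint) (simp_all add: P_closed)
    also have "P i (P j (e j)) = \<zero>\<^bsub>H\<^esub>"
      using e' ij 3 by (intro P_nonedge) auto
    also have "cinner H (e i) \<zero>\<^bsub>H\<^esub> = 0"
      using e' ij by (simp add: cinner_zero_right)
    finally show ?thesis using 3 by (simp add: adj_def)
  qed (use e ij no_loop in \<open>auto simp: linked_family_def adj_def\<close>)
qed

end

lemma representation_imp_tau_le:
  fixes G :: "nat pair_pre_digraph" and \<pi> :: "nat nc_poly set \<Rightarrow> 'h \<Rightarrow> 'h"
  assumes tree: "undirected_tree G" and V: "pverts G = {1..n}" and ab: "(a, b) \<in> parcs G"
    and \<tau>: "0 < \<tau>" and rep: "nontrivial_representation G \<tau> H \<pi>"
  shows "\<tau> \<le> 1 / (graph_index G)\<^sup>2"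
proof -
  have G: "pair_graph G" using tree by (simp add: undirected_tree_def)
  interpret pair_graph G by fact
  have star: "star_representation (graph_algebra G \<tau>) H \<pi>" and hil: "complex_hilbert_space H"
    using rep by (simp_all add: nontrivial_representation_def star_representation_def)
  interpret H: complex_hilbert_space H by fact
  have wf: "i \<in> pverts G \<and> j \<in> pverts G" "i \<noteq> j" if "(i, j) \<in> parcs G" for i j
    using that wellformed no_loops by fastforce+
  interpret R: graph_representation G \<tau> H \<pi>
  proof unfold_locales
    show "(i, i) \<notin> parcs G" for i using wf(2) by blast
  qed (use wf(1) pair_graph_arc_sym[OF G] star \<tau> in blast)+
  obtain i x where "i \<in> pverts G" "x \<in> carrier H" "R.P i x \<noteq> \<zero>\<^bsub>H\<^esub>"
    using rep by (auto simp: nontrivial_representation_def R.P_def R.proj_gen_eq)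
  then have "\<exists>e. R.linked_family {i} e" "i \<in> pverts G"
    by (auto intro: R.linked_family_root)
  then have "\<exists>e. R.linked_family (pverts G) e"
    using tree R.linked_family_extend
    by (intro undirected_tree_grow[of G i "\<lambda>S. \<exists>e. R.linked_family S e"]) blast+
  then obtain e where e: "R.linked_family {1..n} e"
    by (auto simp: V)
  define r where "r = graph_index G"
  obtain v k where k: "k \<in> {1..n}" "v k \<noteq> 0"
    and v: "\<And>i. i \<in> {1..n} \<Longrightarrow> (\<Sum>j\<in>{1..n}. adj G i j * v j) = r * v i"
    using graph_index_eigenvector[OF G V ab] unfolding r_def by blast
  have "0 \<le> Re (\<Sum>i\<in>{1..n}. \<Sum>j\<in>{1..n}. complex_of_real (v i * v j) * cinner H (e i) (e j))"
    using e by (intro H.gram_form_nonneg) (auto simp: R.linked_family_def)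
  also have "(\<Sum>i\<in>{1..n}. \<Sum>j\<in>{1..n}. complex_of_real (v i * v j) * cinner H (e i) (e j)) =
      complex_of_real (\<Sum>i\<in>{1..n}. \<Sum>j\<in>{1..n}. v i * v j * ((if i = j then 1 else 0) - sqrt \<tau> * adj G i j))"
    using R.linked_family_cinner[unfolded V, OF e] by simp
  also have "(\<Sum>i\<in>{1..n}. \<Sum>j\<in>{1..n}. v i * v j * ((if i = j then 1 else 0) - sqrt \<tau> * adj G i j)) =
      (\<Sum>i\<in>{1..n}. v i * v i - sqrt \<tau> * v i * (\<Sum>j\<in>{1..n}. adj G i j * v j))"
  proof (intro sum.cong refl)
    fix i assume i: "i \<in> {1..n}"
    have "(\<Sum>j\<in>{1..n}. v i * v j * ((if i = j then 1 else 0) - sqrt \<tau> * adj G i j)) =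
        (\<Sum>j\<in>{1..n}. (if i = j then v i * v j else 0) - sqrt \<tau> * v i * (adj G i j * v j))"
      by (intro sum.cong refl) (simp add: algebra_simps)
    then show "(\<Sum>j\<in>{1..n}. v i * v j * ((if i = j then 1 else 0) - sqrt \<tau> * adj G i j)) =
        v i * v i - sqrt \<tau> * v i * (\<Sum>j\<in>{1..n}. adj G i j * v j)"
      using i by (simp only: sum_subtractf sum_distrib_left[symmetric]) simp
  qed
  \<comment> \<open>The eigenvalue equation replaces the inner sum by \<open>r * v i\<close>, so the
    form becomes a multiple of the squared norm of \<open>v\<close>.\<close>
  also have "\<dots> = (\<Sum>i\<in>{1..n}. (1 - sqrt \<tau> * r) * (v i)\<^sup>2)"
    by (intro sum.cong refl) (simp only: v, simp add: power2_eq_square algebra_simps)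
  also have "\<dots> = (1 - sqrt \<tau> * r) * (\<Sum>i\<in>{1..n}. (v i)\<^sup>2)"
    by (rule sum_distrib_left[symmetric])
  finally have "0 \<le> (1 - sqrt \<tau> * r) * (\<Sum>i\<in>{1..n}. (v i)\<^sup>2)" by simp
  moreover have "0 < (\<Sum>i\<in>{1..n}. (v i)\<^sup>2)"
    using k by (intro sum_pos2[of _ k]) auto
  ultimately have "0 \<le> 1 - sqrt \<tau> * r"
    by (meson mult_neg_pos not_le)
  then have "sqrt \<tau> * r \<le> 1"
    by simp
  then have "(sqrt \<tau> * r)\<^sup>2 \<le> 1"
    using \<tau> one_le_graph_index[OF G V ab] by (simp add: r_def power_le_one)
  moreover have "0 < r"
    using one_le_graph_index[OF G V ab] by (simp add: r_def)
  ultimately show ?thesis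
    using \<tau> by (simp add: power_mult_distrib r_def pos_le_divide_eq)
qed

section \<open>Representations obtained from a Gram matrix\<close>

text \<open>Vanishing off \<open>V\<close> makes a function on the whole type the same thing as a
  tuple indexed by \<open>V\<close>, so coordinate vectors have unique representatives.\<close>

definition supported_on :: "'v set \<Rightarrow> ('v \<Rightarrow> complex) set" where
  "supported_on V = {v. \<forall>i. i \<notin> V \<longrightarrow> v i = 0}"

lemma supported_on_closed:
  "(\<lambda>_. 0) \<in> supported_on V"
  "\<lbrakk>v \<in> supported_on V; w \<in> supported_on V\<rbrakk> \<Longrightarrow> (\<lambda>i. v i + w i) \<in> supported_on V"
  "\<lbrakk>v \<in> supported_on V; w \<in> supported_on V\<rbrakk> \<Longrightarrow> (\<lambda>i. v i - w i) \<in> supported_on V"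
  "v \<in> supported_on V \<Longrightarrow> (\<lambda>i. - v i) \<in> supported_on V"
  "v \<in> supported_on V \<Longrightarrow> (\<lambda>i. c * v i) \<in> supported_on V"
  "(\<lambda>i. if i \<in> V then f i else 0) \<in> supported_on V"
  by (auto simp: supported_on_def)

text \<open>An infinite set is equinumerous with its square, so coordinates can be merged one at a
  time into a single complex number. This lets the space enter any type that contains a copy of the
  complex numbers.\<close>

lemma ex_inj_on_supported_on:
  assumes "finite V"
  shows "\<exists>g :: ('v \<Rightarrow> complex) \<Rightarrow> complex. inj_on g (supported_on V)"
  using assms
proof (induction V rule: finite_induct)
  case empty
  have "inj_on (\<lambda>_. 0 :: complex) (supported_on {})"
    by (auto simp: inj_on_def supported_on_def)
  then show ?case by blast
next
  case (insert x F)
  then obtain g :: "('v \<Rightarrow> complex) \<Rightarrow> complex" where g: "inj_on g (supported_on F)"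
    by blast
  have "infinite (UNIV :: complex set)"
    by (rule infinite_UNIV_char_0)
  then have "\<exists>p. bij_betw p (UNIV \<times> UNIV :: (complex \<times> complex) set) (UNIV :: complex set)"
    unfolding card_of_ordIso by (rule card_of_Times_same_infinite)
  then obtain p :: "complex \<times> complex \<Rightarrow> complex" where p: "inj p"
    by (auto simp: bij_betw_def)
  have "inj_on (\<lambda>v. p (v x, g (v(x := 0)))) (supported_on (insert x F))"
  proof (rule inj_onI)
    fix v w assume vw: "v \<in> supported_on (insert x F)" "w \<in> supported_on (insert x F)"
      and "p (v x, g (v(x := 0))) = p (w x, g (w(x := 0)))"
    then have x: "v x = w x" and "g (v(x := 0)) = g (w(x := 0))"
      using injD[OF p] by blast+
    moreover have "v(x := 0) \<in> supported_on F" "w(x := 0) \<in> supported_on F"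
      using vw by (auto simp: supported_on_def)
    ultimately have "v(x := 0) = w(x := 0)"
      using inj_onD[OF g] by blast
    then show "v = w"
      using x by (metis fun_upd_triv fun_upd_upd)
  qed
  then show ?case by blast
qed

text \<open>Finite-dimensional coordinate space, with vectors renamed along \<open>g\<close> into another type.\<close>

definition coordinate_space :: "'v set \<Rightarrow> (('v \<Rightarrow> complex) \<Rightarrow> 'h) \<Rightarrow> 'h inner_space" where
  "coordinate_space V g =
     (let h = the_inv_into (supported_on V) g in
      \<lparr>carrier = g ` supported_on V, monoid.mult = (\<lambda>x y. x), one = g (\<lambda>_. 0), zero = g (\<lambda>_. 0),
       add = (\<lambda>x y. g (\<lambda>i. h x i + h y i)), smult = (\<lambda>c x. g (\<lambda>i. c * h x i)),
       cinner = (\<lambda>x y. \<Sum>i\<in>V. h x i * cnj (h y i))\<rparr>)"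

lemma cring_complex_ring: "cring complex_ring"
proof (rule cringI)
  show "abelian_group complex_ring"
  proof (rule abelian_groupI)
    fix x :: complex assume "x \<in> carrier complex_ring"
    then show "\<exists>y \<in> carrier complex_ring. y \<oplus>\<^bsub>complex_ring\<^esub> x = \<zero>\<^bsub>complex_ring\<^esub>"
      by (intro bexI[of _ "- x"]) (auto simp: complex_ring_def)
  qed (auto simp: complex_ring_def add_ac)
  show "Group.comm_monoid complex_ring"
    by (rule comm_monoidI) (auto simp: complex_ring_def)
qed (auto simp: complex_ring_def distrib_right)

section \<open>Finite-dimensional coordinate space as a Hilbert space\<close>

locale coordinates =
  fixes V :: "'v set" and g :: "('v \<Rightarrow> complex) \<Rightarrow> 'h"
  assumes finite_V: "finite V" and inj_g: "inj_on g (supported_on V)"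
begin

abbreviation "C \<equiv> supported_on V"
abbreviation "H \<equiv> coordinate_space V g"

lemma inv_g: "v \<in> C \<Longrightarrow> the_inv_into C g (g v) = v"
  by (rule the_inv_into_f_f[OF inj_g])

lemma H_carrier: "carrier H = g ` C" and H_zero: "\<zero>\<^bsub>H\<^esub> = g (\<lambda>_. 0)"
  by (simp_all add: coordinate_space_def Let_def)

lemma H_add: "\<lbrakk>v \<in> C; w \<in> C\<rbrakk> \<Longrightarrow> g v \<oplus>\<^bsub>H\<^esub> g w = g (\<lambda>i. v i + w i)"
  and H_smult: "v \<in> C \<Longrightarrow> c \<odot>\<^bsub>H\<^esub> g v = g (\<lambda>i. c * v i)"
  and H_cinner: "\<lbrakk>v \<in> C; w \<in> C\<rbrakk> \<Longrightarrow> cinner H (g v) (g w) = (\<Sum>i\<in>V. v i * cnj (w i))"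
  by (simp_all add: coordinate_space_def Let_def inv_g)

lemmas H_simps = H_add H_smult H_cinner H_zero supported_on_closed

lemma g_eq_iff: "\<lbrakk>v \<in> C; w \<in> C\<rbrakk> \<Longrightarrow> g v = g w \<longleftrightarrow> v = w"
  using inj_g by (auto dest: inj_onD)

lemma H_abelian_group: "abelian_group H"
proof (rule abelian_groupI)
  fix x assume "x \<in> carrier H"
  then obtain v where "x = g v" "v \<in> C" by (auto simp: H_carrier)
  then show "\<exists>y\<in>carrier H. y \<oplus>\<^bsub>H\<^esub> x = \<zero>\<^bsub>H\<^esub>"
    by (intro bexI[of _ "g (\<lambda>i. - v i)"]) (auto simp: H_carrier H_simps)
qed (auto simp: H_carrier H_simps add_ac)

lemma H_module: "Module.module complex_ring H"
  by (intro module.intro module_axioms.intro cring_complex_ring H_abelian_group)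
    (auto simp: H_carrier H_simps complex_ring_def algebra_simps)

lemma H_minus:
  assumes "v \<in> C" "w \<in> C"
  shows "g v \<ominus>\<^bsub>H\<^esub> g w = g (\<lambda>i. v i - w i)"
proof -
  interpret abelian_group H by (rule H_abelian_group)
  have "\<ominus>\<^bsub>H\<^esub> g w = g (\<lambda>i. - w i)"
    using assms by (intro minus_equality) (auto simp: H_carrier H_simps)
  then show ?thesis
    using assms by (simp add: a_minus_def H_simps)
qed

lemma H_cinner_self:
  "v \<in> C \<Longrightarrow> cinner H (g v) (g v) = complex_of_real (\<Sum>i\<in>V. (cmod (v i))\<^sup>2)"
  by (simp only: H_cinner of_real_sum complex_norm_square)

lemma H_cnorm: "v \<in> C \<Longrightarrow> cnorm H (g v) = L2_set (\<lambda>i. cmod (v i)) V"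
  by (simp add: cnorm_def H_cinner_self L2_set_def)

lemma coordinate_cmod_le_cnorm:
  assumes "v \<in> C" "i \<in> V"
  shows "cmod (v i) \<le> cnorm H (g v)"
  using member_le_L2_set[OF finite_V assms(2), of "\<lambda>i. cmod (v i)"] assms(1) by (simp add: H_cnorm)

text \<open>Each coordinate is dominated by the norm and hence Cauchy; as \<open>V\<close> is
  finite, the coordinatewise limits form a limit in norm.\<close>

lemma H_complete:
  assumes X: "\<And>n. X n \<in> carrier H"
    and cauchy: "\<And>e. 0 < e \<Longrightarrow> \<exists>N. \<forall>m\<ge>N. \<forall>n\<ge>N. cnorm H (X m \<ominus>\<^bsub>H\<^esub> X n) < e"
  shows "\<exists>L \<in> carrier H. (\<lambda>n. cnorm H (X n \<ominus>\<^bsub>H\<^esub> L)) \<longlonglongrightarrow> 0"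
proof -
  have "\<exists>v. X n = g v \<and> v \<in> C" for n
    using X[of n] by (auto simp: H_carrier)
  then obtain v where v: "\<And>n. X n = g (v n)" "\<And>n. v n \<in> C"
    by metis
  have "Cauchy (\<lambda>n. v n i)" if "i \<in> V" for i
  proof (rule CauchyI)
    fix e :: real assume "0 < e"
    then obtain N where N: "\<And>m n. \<lbrakk>m \<ge> N; n \<ge> N\<rbrakk> \<Longrightarrow> cnorm H (X m \<ominus>\<^bsub>H\<^esub> X n) < e"
      using cauchy by blast
    have "norm (v m i - v n i) < e" if "m \<ge> N" "n \<ge> N" for m n
      using coordinate_cmod_le_cnorm[OF supported_on_closed(3)[OF v(2)[of m] v(2)[of n]] \<open>i \<in> V\<close>] N[OF that]
      by (simp add: v H_minus)
    then show "\<exists>M. \<forall>m\<ge>M. \<forall>n\<ge>M. norm (v m i - v n i) < e" by blast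
  qed
  then have "\<forall>i\<in>V. \<exists>l. (\<lambda>n. v n i) \<longlonglongrightarrow> l"
    by (auto simp: Cauchy_convergent_iff convergent_def)
  then obtain l where l: "\<And>i. i \<in> V \<Longrightarrow> (\<lambda>n. v n i) \<longlonglongrightarrow> l i"
    by metis
  \<comment> \<open>Off \<open>V\<close> nothing is known about \<open>l\<close>; the value 0 there
    keeps the limit in \<open>C\<close>.\<close>
  define L where "L i = (if i \<in> V then l i else 0)" for i
  have L: "L \<in> C"
    by (simp add: L_def[abs_def] supported_on_closed)
  have "(\<lambda>n. \<Sum>i\<in>V. (cmod (v n i - L i))\<^sup>2) \<longlonglongrightarrow> (\<Sum>i\<in>V. (cmod (L i - L i))\<^sup>2)"
    using l by (intro tendsto_intros) (simp add: L_def)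
  then have "(\<lambda>n. sqrt (\<Sum>i\<in>V. (cmod (v n i - L i))\<^sup>2)) \<longlonglongrightarrow> sqrt (\<Sum>i\<in>V. (cmod (L i - L i))\<^sup>2)"
    by (rule tendsto_real_sqrt)
  then have "(\<lambda>n. cnorm H (X n \<ominus>\<^bsub>H\<^esub> g L)) \<longlonglongrightarrow> 0"
    using v L by (simp add: H_minus H_cnorm supported_on_closed L2_set_def)
  then show ?thesis
    using L by (auto simp: H_carrier)
qed

lemma H_hilbert: "complex_hilbert_space H"
proof (intro complex_hilbert_space.intro complex_hilbert_space_axioms.intro H_module H_complete)
  fix x y z c
  assume "x \<in> carrier H" "y \<in> carrier H"
  then obtain v w where vw: "x = g v" "v \<in> C" "y = g w" "w \<in> C"
    by (auto simp: H_carrier)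
  show "cinner H (c \<odot>\<^bsub>H\<^esub> x) y = c * cinner H x y"
    using vw by (simp add: H_simps sum_distrib_left mult.assoc)
  show "cinner H x y = cnj (cinner H y x)"
    using vw by (simp add: H_simps mult.commute)
  assume "z \<in> carrier H"
  then obtain u where "z = g u" "u \<in> C"
    by (auto simp: H_carrier)
  then show "cinner H (x \<oplus>\<^bsub>H\<^esub> y) z = cinner H x z + cinner H y z"
    using vw by (simp add: H_simps algebra_simps sum.distrib)
next
  fix x assume "x \<in> carrier H" "x \<noteq> \<zero>\<^bsub>H\<^esub>"
  then obtain v where v: "x = g v" "v \<in> C" "v \<noteq> (\<lambda>_. 0)"
    by (auto simp: H_carrier H_zero)
  then obtain i where "v i \<noteq> 0" "i \<in> V"
    by (auto simp: fun_eq_iff supported_on_def)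
  then have "0 < (\<Sum>i\<in>V. (cmod (v i))\<^sup>2)"
    using finite_V by (intro sum_pos2[of _ i]) auto
  then show "0 < Re (cinner H x x)"
    using v by (simp add: H_cinner_self)
qed

definition apply_matrix :: "('v \<Rightarrow> 'v \<Rightarrow> complex) \<Rightarrow> ('v \<Rightarrow> complex) \<Rightarrow> 'v \<Rightarrow> complex" where
  "apply_matrix M v i = (if i \<in> V then \<Sum>j\<in>V. M i j * v j else 0)"

lemma apply_matrix_supported: "apply_matrix M v \<in> C"
  by (simp add: supported_on_def apply_matrix_def)

text \<open>The norm is at most the sum of the absolute values of the coordinates, and each
  coordinate of \<open>v\<close> is at most its norm. This crude constant is enough for
  boundedness.\<close>

lemma apply_matrix_bounded:
  assumes "v \<in> C"
  shows "cnorm H (g (apply_matrix M v)) \<le> (\<Sum>i\<in>V. \<Sum>j\<in>V. cmod (M i j)) * cnorm H (g v)"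
proof -
  have "cnorm H (g (apply_matrix M v)) \<le> (\<Sum>i\<in>V. cmod (apply_matrix M v i))"
    by (simp add: H_cnorm apply_matrix_supported L2_set_le_sum)
  also have "\<dots> \<le> (\<Sum>i\<in>V. \<Sum>j\<in>V. cmod (M i j) * cnorm H (g v))"
    using assms
    by (intro sum_mono)
      (auto simp: apply_matrix_def norm_mult intro!: sum_norm_le mult_left_mono coordinate_cmod_le_cnorm)
  finally show ?thesis
    by (simp add: sum_distrib_right)
qed

lemma bounded_operator_apply_matrix:
  assumes T: "\<And>v. v \<in> C \<Longrightarrow> T (g v) = g (apply_matrix M v)"
  shows "bounded_operator H T"
  unfolding bounded_operator_def
proof (intro conjI allI ballI exI[of _ "\<Sum>i\<in>V. \<Sum>j\<in>V. cmod (M i j)"])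
  fix x c assume "x \<in> carrier H"
  then obtain v where v: "x = g v" "v \<in> C" by (auto simp: H_carrier)
  show "T x \<in> carrier H"
    using v by (simp add: T H_carrier apply_matrix_supported)
  show "T (c \<odot>\<^bsub>H\<^esub> x) = c \<odot>\<^bsub>H\<^esub> T x"
    using v by (simp add: T H_simps apply_matrix_supported)
      (auto simp: apply_matrix_def sum_distrib_left mult_ac intro!: arg_cong[of _ _ g])
  show "cnorm H (T x) \<le> (\<Sum>i\<in>V. \<Sum>j\<in>V. cmod (M i j)) * cnorm H x"
    using v by (simp add: T apply_matrix_bounded)
  fix y assume "y \<in> carrier H"
  then obtain w where "y = g w" "w \<in> C" by (auto simp: H_carrier)
  then show "T (x \<oplus>\<^bsub>H\<^esub> y) = T x \<oplus>\<^bsub>H\<^esub> T y"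
    using v by (simp add: T H_simps apply_matrix_supported)
      (auto simp: apply_matrix_def distrib_left sum.distrib intro!: arg_cong[of _ _ g])
qed

lemma adjoint_apply_matrix:
  assumes "v \<in> C" "w \<in> C" "\<And>i j. \<lbrakk>i \<in> V; j \<in> V\<rbrakk> \<Longrightarrow> N j i = cnj (M i j)"
  shows "cinner H (g (apply_matrix M v)) (g w) = cinner H (g v) (g (apply_matrix N w))"
proof -
  have "cinner H (g (apply_matrix M v)) (g w) = (\<Sum>i\<in>V. \<Sum>j\<in>V. M i j * v j * cnj (w i))"
    using assms by (simp add: H_cinner apply_matrix_supported)
      (simp add: apply_matrix_def sum_distrib_right)
  also have "\<dots> = (\<Sum>j\<in>V. \<Sum>i\<in>V. M i j * v j * cnj (w i))"
    by (rule sum.swap)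
  also have "\<dots> = cinner H (g v) (g (apply_matrix N w))"
    using assms by (simp add: H_cinner apply_matrix_supported)
      (simp add: apply_matrix_def sum_distrib_left mult_ac)
  finally show ?thesis .
qed

end

section \<open>Rank-one projections onto vectors with the prescribed Gram matrix\<close>

locale gram_representation = graph_relations G \<tau> + coordinates "pverts G" g
  for G :: "'v pair_pre_digraph" and \<tau> :: real and g :: "('v \<Rightarrow> complex) \<Rightarrow> 'h" +
  fixes e :: "'v \<Rightarrow> 'v \<Rightarrow> real"
  assumes gram: "\<lbrakk>k \<in> pverts G; l \<in> pverts G\<rbrakk> \<Longrightarrow>
      (\<Sum>m\<in>pverts G. e k m * e l m) = (if k = l then 1 else 0) - sqrt \<tau> * adj G k l"
    and tau_pos: "0 < \<tau>"
    and no_loop: "(i, i) \<notin> parcs G"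
begin

abbreviation "V \<equiv> pverts G"

text \<open>Each letter \<open>k\<close> acts as the orthogonal projection onto the unit vector \<open>e k\<close>.\<close>

primrec word_matrix :: "'v list \<Rightarrow> 'v \<Rightarrow> 'v \<Rightarrow> complex" where
  "word_matrix [] i j = (if i = j then 1 else 0)"
| "word_matrix (k # ks) i j = of_real (e k i) * (\<Sum>m\<in>V. of_real (e k m) * word_matrix ks m j)"

lemma word_matrix_append:
  assumes "i \<in> V"
  shows "word_matrix (a @ b) i j = (\<Sum>m\<in>V. word_matrix a i m * word_matrix b m j)"
  using assms
proof (induction a arbitrary: i)
  case Nil
  then show ?case
    using finite_V by (simp add: if_distrib[of "\<lambda>x. x * _"] cong: if_cong)
next
  case (Cons k a)
  have "word_matrix ((k # a) @ b) i j =
      of_real (e k i) * (\<Sum>m\<in>V. of_real (e k m) * (\<Sum>l\<in>V. word_matrix a m l * word_matrix b l j))"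
    using Cons.IH by (simp cong: sum.cong)
  also have "\<dots> = (\<Sum>m\<in>V. \<Sum>l\<in>V. of_real (e k i) * (of_real (e k m) * (word_matrix a m l * word_matrix b l j)))"
    by (simp add: sum_distrib_left)
  also have "\<dots> = (\<Sum>l\<in>V. \<Sum>m\<in>V. of_real (e k i) * (of_real (e k m) * (word_matrix a m l * word_matrix b l j)))"
    by (rule sum.swap)
  also have "\<dots> = (\<Sum>l\<in>V. word_matrix (k # a) i l * word_matrix b l j)"
    by (simp add: sum_distrib_left sum_distrib_right mult.assoc)
  finally show ?case .
qed

lemma word_matrix_singleton: "j \<in> V \<Longrightarrow> word_matrix [k] i j = of_real (e k i * e k j)"
  using finite_V by (simp add: if_distrib cong: if_cong)

text \<open>Each letter acts by a real symmetric matrix, so reversing a product amounts to conjugate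
  transposition. This is the source of compatibility with the involution.\<close>

lemma word_matrix_rev:
  assumes "i \<in> V" "j \<in> V"
  shows "word_matrix (rev w) i j = cnj (word_matrix w j i)"
  using assms
proof (induction w arbitrary: j)
  case (Cons k w)
  have "word_matrix (rev (k # w)) i j = (\<Sum>m\<in>V. word_matrix (rev w) i m * word_matrix [k] m j)"
    using Cons.prems by (simp only: rev.simps word_matrix_append)
  also have "\<dots> = (\<Sum>m\<in>V. cnj (word_matrix w m i) * of_real (e k m * e k j))"
    using Cons by (intro sum.cong refl) (simp only: word_matrix_singleton)
  also have "\<dots> = cnj (word_matrix (k # w) j i)"
    by (simp add: sum_distrib_left mult_ac)
  finally show ?case .
qed auto

definition eval_matrix :: "'v nc_poly \<Rightarrow> 'v \<Rightarrow> 'v \<Rightarrow> complex" where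
  "eval_matrix f i j =
     (\<Sum>w\<in>Poly_Mapping.keys f. Poly_Mapping.lookup f w * word_matrix (letters w) i j)"

text \<open>A common finite set of words can serve two polynomials and their sum, even when
  coefficients cancel in the sum.\<close>

lemma eval_matrix_superset:
  assumes "finite S" "Poly_Mapping.keys f \<subseteq> S"
  shows "eval_matrix f i j = (\<Sum>w\<in>S. Poly_Mapping.lookup f w * word_matrix (letters w) i j)"
  unfolding eval_matrix_def using assms by (intro sum.mono_neutral_left) (auto simp: in_keys_iff)

lemma eval_matrix_add: "eval_matrix (f + f') i j = eval_matrix f i j + eval_matrix f' i j"
proof -
  let ?S = "Poly_Mapping.keys f \<union> Poly_Mapping.keys f'"
  have "finite ?S" "Poly_Mapping.keys (f + f') \<subseteq> ?S"
    using Poly_Mapping.keys_add[of f f'] by auto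
  then show ?thesis
    by (simp add: eval_matrix_superset[of ?S] lookup_add distrib_right sum.distrib)
qed

lemma eval_matrix_zero [simp]: "eval_matrix 0 i j = 0"
  by (simp add: eval_matrix_def)

lemma eval_matrix_single:
  "eval_matrix (Poly_Mapping.single w c) i j = c * word_matrix (letters w) i j"
  by (simp add: eval_matrix_def)

lemma eval_matrix_diff: "eval_matrix (f - f') i j = eval_matrix f i j - eval_matrix f' i j"
  using eval_matrix_add[of "f - f'" f' i j] by simp

lemma eval_matrix_uminus: "eval_matrix (- f) i j = - eval_matrix f i j"
  using eval_matrix_diff[of 0 f i j] by simp

lemma eval_matrix_scale: "eval_matrix (nc_scale c f) i j = c * eval_matrix f i j"
  by (induction f rule: poly_mapping_additive_induct)
    (simp_all add: nc_scale_single nc_scale_add eval_matrix_single eval_matrix_add algebra_simps)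

lemma eval_matrix_one: "eval_matrix 1 i j = (if i = j then 1 else 0)"
  by (simp add: single_one[symmetric] eval_matrix_single zero_gen_word_def)

lemma eval_matrix_mult:
  assumes "i \<in> V"
  shows "eval_matrix (f * f') i j = (\<Sum>m\<in>V. eval_matrix f i m * eval_matrix f' m j)"
proof (induction f rule: poly_mapping_additive_induct)
  case (single v c)
  show ?case
  proof (induction f' rule: poly_mapping_additive_induct)
    case (single w d)
    show ?case
      using assms
      by (simp add: mult_single eval_matrix_single plus_gen_word_def word_matrix_append
          sum_distrib_left mult_ac)
  qed (simp_all add: distrib_left eval_matrix_add sum.distrib)
qed (simp_all add: distrib_right eval_matrix_add sum.distrib)

lemma eval_matrix_star:
  assumes "i \<in> V" "j \<in> V"
  shows "eval_matrix (nc_star f) i j = cnj (eval_matrix f j i)"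
  using assms
  by (induction f rule: poly_mapping_additive_induct)
    (simp_all add: nc_star_single nc_star_add eval_matrix_single eval_matrix_add rev_word_def word_matrix_rev)

lemma eval_matrix_gen: "j \<in> V \<Longrightarrow> eval_matrix (gen k) i j = of_real (e k i * e k j)"
  by (simp add: gen_def eval_matrix_single word_matrix_singleton del: word_matrix.simps)

lemma eval_matrix_gen_gen:
  assumes "k \<in> V" "l \<in> V" "i \<in> V" "j \<in> V"
  shows "eval_matrix (gen k * gen l) i j =
      of_real (e k i * ((if k = l then 1 else 0) - sqrt \<tau> * adj G k l) * e l j)"
proof -
  have "eval_matrix (gen k * gen l) i j = (\<Sum>m\<in>V. of_real (e k i * (e k m * e l m) * e l j))"
    using assms by (simp add: eval_matrix_mult eval_matrix_gen mult_ac)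
  also have "\<dots> = of_real (e k i * (\<Sum>m\<in>V. e k m * e l m) * e l j)"
    by (simp add: sum_distrib_left sum_distrib_right)
  finally show ?thesis
    using assms by (simp only: gram)
qed

text \<open>For rank-one projections, \<open>p k p l p k\<close> is \<open>p k\<close> times the
  square of the inner product of \<open>e k\<close> and \<open>e l\<close>. The Gram matrix supplies
  1 on the diagonal, - sqrt \<tau> on edges, whose square is \<tau>, and 0 elsewhere.\<close>

lemma eval_matrix_relator:
  assumes f: "f \<in> relators G \<tau>" and ij: "i \<in> V" "j \<in> V"
  shows "eval_matrix f i j = 0"
proof -
  consider k where "k \<in> V" "f = gen k * gen k - gen k"
    | k l where "(k, l) \<in> parcs G" "f = gen k * gen l * gen k - nc_scale (complex_of_real \<tau>) (gen k)"
    | k l where "k \<in> V" "l \<in> V" "k \<noteq> l" "(k, l) \<notin> parcs G" "f = gen k * gen l"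
    using f by (auto simp: relators_def)
  then show ?thesis
  proof cases
    case 1
    then show ?thesis
      using ij no_loop by (simp add: eval_matrix_diff eval_matrix_gen_gen eval_matrix_gen adj_def)
  next
    case 2
    have kl: "k \<in> V" "l \<in> V" "k \<noteq> l" and lk: "(l, k) \<in> parcs G"
      using 2(1) arc_verts arc_sym no_loop by auto
    have "eval_matrix (gen k * gen l * gen k) i j =
        (\<Sum>m\<in>V. of_real (e k i * - sqrt \<tau> * (e l m * e k m) * e k j))"
      using ij kl 2(1)
      by (subst eval_matrix_mult) (simp_all add: eval_matrix_gen_gen eval_matrix_gen adj_def mult_ac)
    also have "\<dots> = of_real (e k i * - sqrt \<tau> * (\<Sum>m\<in>V. e l m * e k m) * e k j)"
      by (simp add: sum_distrib_left sum_distrib_right)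
    also have "(\<Sum>m\<in>V. e l m * e k m) = - sqrt \<tau>"
      using kl lk by (simp add: gram adj_def)
    also have "e k i * - sqrt \<tau> * - sqrt \<tau> * e k j = sqrt \<tau> * sqrt \<tau> * (e k i * e k j)"
      by (simp only: mult_minus_left mult_minus_right minus_minus mult_ac)
    also have "sqrt \<tau> * sqrt \<tau> = \<tau>"
      using tau_pos by simp
    finally show ?thesis
      using ij 2 by (simp add: eval_matrix_diff eval_matrix_scale eval_matrix_gen)
  next
    case 3
    then show ?thesis
      using ij by (simp add: eval_matrix_gen_gen adj_def)
  qed
qed

text \<open>Evaluation is multiplicative on indices in \<open>V\<close>, so the polynomials whose
  matrix vanishes there form an ideal, and only the relators have to be checked.\<close>

lemma eval_matrix_ideal:
  assumes "f \<in> I" "i \<in> V" "j \<in> V"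
  shows "eval_matrix f i j = 0"
proof -
  let ?J = "{f \<in> carrier A. \<forall>i\<in>V. \<forall>j\<in>V. eval_matrix f i j = 0}"
  have "ideal ?J A"
  proof (rule idealI)
    show "subgroup ?J (add_monoid A)"
    proof (rule A.add.subgroupI)
      show "?J \<noteq> {}" using A_closed(2) by (auto intro!: exI[of _ 0])
    qed (auto simp: eval_matrix_add eval_matrix_uminus free_star_algebra_a_inv A_closed)
  qed (auto simp: eval_matrix_mult A_closed A.ring_axioms)
  moreover have "relators G \<tau> \<subseteq> ?J"
    using relators_in_carrier eval_matrix_relator by blast
  ultimately have "I \<subseteq> ?J"
    unfolding relation_ideal_def by (rule A.genideal_minimal)
  then show ?thesis using assms by blast
qed

text \<open>A coset acts through an arbitrarily chosen member. By \<open>eval_matrix_ideal\<close>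
  the choice does not affect the entries over \<open>V\<close>, and \<open>apply_matrix\<close>
  reads no others.\<close>

definition rep :: "'v nc_poly set \<Rightarrow> 'h \<Rightarrow> 'h" where
  "rep X x = g (apply_matrix (eval_matrix (SOME f. f \<in> X)) (the_inv_into C g x))"

lemma rep_cls:
  assumes f: "f \<in> carrier A" and v: "v \<in> C"
  shows "rep (cls f) (g v) = g (apply_matrix (eval_matrix f) v)"
proof -
  define f' where "f' = (SOME f'. f' \<in> cls f)"
  have "f \<in> cls f"
    using f I.zero_closed by (simp add: mem_cls_iff)
  then have "f' \<in> cls f"
    unfolding f'_def by (rule someI)
  then have diff: "f' - f \<in> I"
    using f by (simp add: mem_cls_iff)
  have "eval_matrix f' i j = eval_matrix f i j" if "i \<in> V" "j \<in> V" for i j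
    using eval_matrix_ideal[OF diff that] by (simp add: eval_matrix_diff)
  then have "apply_matrix (eval_matrix f') v = apply_matrix (eval_matrix f) v"
    by (auto simp: apply_matrix_def fun_eq_iff)
  then show ?thesis
    using v by (simp add: rep_def inv_g f'_def)
qed

text \<open>The vector \<open>e k\<close> is the witness: it has norm 1 and its own projection fixes
  it. It shows at once that the space is nonzero and that the representation is nontrivial.\<close>

lemma rep_generator_fixes:
  assumes k: "k \<in> V"
  shows "\<exists>x\<in>carrier H. x \<noteq> \<zero>\<^bsub>H\<^esub> \<and> rep (proj_gen G \<tau> k) x = x"
proof -
  define v where "v i = (if i \<in> V then complex_of_real (e k i) else 0)" for i
  have v: "v \<in> C"
    by (simp add: v_def[abs_def] supported_on_closed)
  have norm: "(\<Sum>m\<in>V. e k m * e k m) = 1"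
    using k no_loop by (simp add: gram adj_def)
  have "v \<noteq> (\<lambda>_. 0)"
  proof
    assume "v = (\<lambda>_. 0)"
    then have "e k i = 0" if "i \<in> V" for i
      using that by (metis of_real_eq_0_iff v_def)
    then show False using norm by simp
  qed
  then have "g v \<noteq> \<zero>\<^bsub>H\<^esub>"
    using v by (simp add: H_zero g_eq_iff supported_on_closed)
  moreover have "apply_matrix (eval_matrix (gen k)) v = v"
  proof
    fix i
    show "apply_matrix (eval_matrix (gen k)) v i = v i"
    proof (cases "i \<in> V")
      case True
      have "(\<Sum>j\<in>V. eval_matrix (gen k) i j * v j) = of_real (e k i * (\<Sum>j\<in>V. e k j * e k j))"
        by (simp add: eval_matrix_gen v_def sum_distrib_left mult.assoc)
      then show ?thesis
        using True norm by (simp add: apply_matrix_def v_def)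
    qed (simp add: apply_matrix_def v_def)
  qed
  ultimately show ?thesis
    using k v by (intro bexI[of _ "g v"]) (simp_all add: proj_gen_eq rep_cls A_closed H_carrier)
qed

lemma star_representation_rep:
  assumes "V \<noteq> {}"
  shows "star_representation Q H rep"
  unfolding star_representation_def
proof (intro conjI allI ballI)
  show "complex_hilbert_space H" by (rule H_hilbert)
  show "carrier H \<noteq> {\<zero>\<^bsub>H\<^esub>}"
    using assms rep_generator_fixes by blast
  fix x assume "x \<in> carrier H"
  then obtain v where v: "x = g v" "v \<in> C" by (auto simp: H_carrier)
  show "rep \<one>\<^bsub>Q\<^esub> x = x"
  proof -
    have "apply_matrix (eval_matrix 1) v = v"
      using v finite_V
      by (auto simp: apply_matrix_def eval_matrix_one fun_eq_iff supported_on_def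
          if_distrib[of "\<lambda>x. x * _"] cong: if_cong)
    then show ?thesis
      using v by (simp add: graph_algebra_one rep_cls A_closed)
  qed
  fix a assume "a \<in> carrier Q"
  then obtain f where f: "a = cls f" "f \<in> carrier A" by (auto simp: graph_algebra_carrier)
  show "rep (c \<odot>\<^bsub>Q\<^esub> a) x = c \<odot>\<^bsub>H\<^esub> rep a x" for c
    using f v
    by (simp add: graph_algebra_smult rep_cls A_closed H_simps apply_matrix_supported)
      (auto simp: apply_matrix_def eval_matrix_scale sum_distrib_left mult.assoc intro!: arg_cong[of _ _ g])
  fix b assume "b \<in> carrier Q"
  then obtain f' where f': "b = cls f'" "f' \<in> carrier A" by (auto simp: graph_algebra_carrier)
  show "rep (a \<oplus>\<^bsub>Q\<^esub> b) x = rep a x \<oplus>\<^bsub>H\<^esub> rep b x"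
    using f f' v
    by (simp add: graph_algebra_add rep_cls A_closed H_simps apply_matrix_supported)
      (auto simp: apply_matrix_def eval_matrix_add distrib_right sum.distrib intro!: arg_cong[of _ _ g])
  have "apply_matrix (eval_matrix (f * f')) v =
      apply_matrix (eval_matrix f) (apply_matrix (eval_matrix f') v)"
  proof
    fix i
    have "(\<Sum>j\<in>V. (\<Sum>m\<in>V. eval_matrix f i m * eval_matrix f' m j) * v j) =
        (\<Sum>j\<in>V. \<Sum>m\<in>V. eval_matrix f i m * (eval_matrix f' m j * v j))"
      by (simp add: sum_distrib_right mult.assoc)
    also have "\<dots> = (\<Sum>m\<in>V. \<Sum>j\<in>V. eval_matrix f i m * (eval_matrix f' m j * v j))"
      by (rule sum.swap)
    finally show "apply_matrix (eval_matrix (f * f')) v i =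
        apply_matrix (eval_matrix f) (apply_matrix (eval_matrix f') v) i"
      by (simp add: apply_matrix_def eval_matrix_mult sum_distrib_left)
  qed
  then show "rep (a \<otimes>\<^bsub>Q\<^esub> b) x = rep a (rep b x)"
    using f f' v by (simp add: graph_algebra_mult rep_cls A_closed apply_matrix_supported)
next
  fix a assume "a \<in> carrier Q"
  then obtain f where f: "a = cls f" "f \<in> carrier A" by (auto simp: graph_algebra_carrier)
  show "bounded_operator H (rep a)"
    using f by (intro bounded_operator_apply_matrix[where M = "eval_matrix f"]) (simp add: rep_cls)
  show "adjoint_operators H (rep a) (rep (involution Q a))"
    using f
    by (auto simp: adjoint_operators_def graph_algebra_involution H_carrier rep_cls A_closed
        eval_matrix_star intro!: adjoint_apply_matrix)
qed

lemma nontrivial_rep: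
  assumes "k \<in> V"
  shows "nontrivial_representation G \<tau> H rep"
proof -
  obtain x where "x \<in> carrier H" "rep (proj_gen G \<tau> k) x \<noteq> \<zero>\<^bsub>H\<^esub>"
    using rep_generator_fixes[OF assms] by metis
  then show ?thesis
    using assms star_representation_rep by (auto simp: nontrivial_representation_def)
qed

end

lemma tau_le_imp_representation:
  fixes G :: "nat pair_pre_digraph" and g :: "complex \<Rightarrow> 'h"
  assumes G: "pair_graph G" and V: "pverts G = {1..n}" and ab: "(a, b) \<in> parcs G"
    and \<tau>: "0 < \<tau>" "\<tau> \<le> 1 / (graph_index G)\<^sup>2" and g: "inj g"
  shows "\<exists>(H :: 'h inner_space) \<pi>. nontrivial_representation G \<tau> H \<pi>"
proof -
  interpret pair_graph G by fact
  define r where "r = graph_index G"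
  have r: "1 \<le> r"
    using one_le_graph_index[OF G V ab] by (simp add: r_def)
  have "(sqrt \<tau> * r)\<^sup>2 \<le> 1\<^sup>2"
    using \<tau> r by (simp add: power_mult_distrib r_def pos_le_divide_eq)
  then have sr: "sqrt \<tau> * r \<le> 1"
    by (rule power2_le_imp_le) simp
  define M where "M k l = (if k = l then 1 else 0) - sqrt \<tau> * adj G k l" for k l
  have "\<exists>e. \<forall>k\<in>{1..n}. \<forall>l\<in>{1..n}. M k l = (\<Sum>m\<in>{1..n}. e k m * e l m)"
  proof (rule gram_factorization)
    show "M k l = M l k" for k l
      using pair_graph_arc_sym[OF G] by (auto simp: M_def adj_def)
    fix v
    have "(\<Sum>i\<in>{1..n}. \<Sum>j\<in>{1..n}. v i * M i j * v j) =
        (\<Sum>i\<in>{1..n}. (v i)\<^sup>2 - sqrt \<tau> * (\<Sum>j\<in>{1..n}. v i * adj G i j * v j))"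
    proof (intro sum.cong refl)
      fix i assume i: "i \<in> {1..n}"
      have "(\<Sum>j\<in>{1..n}. v i * M i j * v j) =
          (\<Sum>j\<in>{1..n}. (if i = j then v i * v j else 0) - sqrt \<tau> * (v i * adj G i j * v j))"
        by (intro sum.cong refl) (simp add: M_def algebra_simps)
      then show "(\<Sum>j\<in>{1..n}. v i * M i j * v j) =
          (v i)\<^sup>2 - sqrt \<tau> * (\<Sum>j\<in>{1..n}. v i * adj G i j * v j)"
        using i by (simp only: sum_subtractf sum_distrib_left[symmetric]) (simp add: power2_eq_square)
    qed
    also have "\<dots> = (\<Sum>i\<in>{1..n}. (v i)\<^sup>2) - sqrt \<tau> * (\<Sum>i\<in>{1..n}. \<Sum>j\<in>{1..n}. v i * adj G i j * v j)"
      by (simp only: sum_subtractf sum_distrib_left[symmetric])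
    finally have form: "(\<Sum>i\<in>{1..n}. \<Sum>j\<in>{1..n}. v i * M i j * v j) =
        (\<Sum>i\<in>{1..n}. (v i)\<^sup>2) - sqrt \<tau> * (\<Sum>i\<in>{1..n}. \<Sum>j\<in>{1..n}. v i * adj G i j * v j)" .
    \<comment> \<open>Since the adjacency form is at most \<open>r\<close> times the squared norm,
      this multiple of the squared norm is a lower bound for the form of \<open>M\<close>.\<close>
    have "0 \<le> (1 - sqrt \<tau> * r) * (\<Sum>i\<in>{1..n}. (v i)\<^sup>2)"
      using sr by (intro mult_nonneg_nonneg sum_nonneg) auto
    also have "\<dots> = (\<Sum>i\<in>{1..n}. (v i)\<^sup>2) - sqrt \<tau> * (r * (\<Sum>i\<in>{1..n}. (v i)\<^sup>2))"
      by (simp only: left_diff_distrib mult.assoc mult_1)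
    also have "\<dots> \<le> (\<Sum>i\<in>{1..n}. \<Sum>j\<in>{1..n}. v i * M i j * v j)"
      unfolding form using adj_form_le_graph_index[OF G V ab, of v] \<tau>
      by (intro diff_left_mono mult_left_mono) (simp_all add: r_def)
    finally show "0 \<le> (\<Sum>i\<in>{1..n}. \<Sum>j\<in>{1..n}. v i * M i j * v j)" .
  qed simp
  then obtain e where e: "\<And>k l. \<lbrakk>k \<in> pverts G; l \<in> pverts G\<rbrakk> \<Longrightarrow> (\<Sum>m\<in>pverts G. e k m * e l m) = M k l"
    unfolding V by metis
  obtain h :: "(nat \<Rightarrow> complex) \<Rightarrow> complex" where h: "inj_on h (supported_on (pverts G))"
    using ex_inj_on_supported_on[of "pverts G"] by (auto simp: V)
  \<comment> \<open>The space reaches \<open>'h\<close> in two moves: tuples are coded as complex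
    numbers, which the given injection then embeds.\<close>
  have inj: "inj_on (g \<circ> h) (supported_on (pverts G))"
    using h g by (simp add: comp_inj_on inj_on_subset)
  have wf: "i \<in> pverts G \<and> j \<in> pverts G" "i \<noteq> j" if "(i, j) \<in> parcs G" for i j
    using that wellformed no_loops by fastforce+
  interpret R: gram_representation G \<tau> "g \<circ> h" e
  proof unfold_locales
    show "(i, i) \<notin> parcs G" for i using wf(2) by blast
    show "finite (pverts G)" by (simp add: V)
    show "(\<Sum>m\<in>pverts G. e k m * e l m) = (if k = l then 1 else 0) - sqrt \<tau> * adj G k l"
      if "k \<in> pverts G" "l \<in> pverts G" for k l
      using e[OF that] by (simp add: M_def)
  qed (use wf(1) pair_graph_arc_sym[OF G] \<tau> inj in blast)+
  show ?thesis
    using R.nontrivial_rep wf(1)[OF ab] by blast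
qed

text \<open>Two vertices guarantee an edge and so an index of at least 1. For a single vertex the
  index is 0, and with \<open>1 / 0 = 0\<close> the interval would be empty, although the identity
  on a one-dimensional space is a nontrivial representation.\<close>

theorem theorem2:
  fixes G :: "nat pair_pre_digraph" and n :: nat
  assumes tree: "undirected_tree G"
    and verts: "pverts G = {1..n}"
    and n: "2 \<le> n"
    and universe: "\<exists>f :: complex \<Rightarrow> 'h. inj f"
  shows "Sigma_set TYPE('h) G = {0 <.. 1 / (graph_index G)\<^sup>2}"
proof -
  have G: "pair_graph G" and con: "Digraph_Component.connected (with_proj G)"
    using tree by (auto simp: undirected_tree_def)
  have verts12: "{1} \<subseteq> pverts G" "2 \<in> pverts G"
    using verts n by auto
  obtain a b where ab: "(a, b) \<in> parcs G"
    by (rule connected_arc_leaving[OF con G verts12(1) _ verts12(2), of 1]) auto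
  obtain f :: "complex \<Rightarrow> 'h" where f: "inj f"
    using universe by blast
  \<comment> \<open>The index is at least 1, so the condition \<tau> \<le> 1 in
    \<open>Sigma_set\<close> follows from the bound by the index.\<close>
  have le1: "\<tau> \<le> 1" if "\<tau> \<le> 1 / (graph_index G)\<^sup>2" for \<tau>
  proof -
    have "1 \<le> (graph_index G)\<^sup>2"
      using one_le_graph_index[OF G verts ab] by (simp add: one_le_power)
    then have "1 / (graph_index G)\<^sup>2 \<le> 1"
      by (subst divide_le_eq_1_pos) auto
    then show ?thesis using that by linarith
  qed
  show ?thesis
    using representation_imp_tau_le[OF tree verts ab]
      tau_le_imp_representation[OF G verts ab _ _ f] le1
    by (auto simp: Sigma_set_def)
qed

end
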